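(* Let $A$ be an irreducible Courant algebroid. Any orthogonal Courant-Nijenhuis tensor $N$ on $A$ is proportional (by a real constant factor) to either a complex Courant structure, or a product Courant structure, or a tangent Courant structure on $A$. That is, $N=cJ$ for some $c\in\mathbb{R}$ and some orthogonal Courant-Nijenhuis tensor $J$ on $A$ with $J^2=-I$, $J^2=I$, or $J^2=0$.
   Context: A Courant algebroid is a vector bundle $A\to M$ with (i) an $\mathbb{R}$-bilinear product $\circ$ on $\mathrm{Sec}(A)$ that is Leibniz, i.e. $(X\circ Y)\circ Z=X\circ(Y\circ Z)-Y\circ(X\circ Z)$; (ii) a vector bundle map $\rho:A\to \mathrm{T}M$ over the identity; (iii) a nondegenerate symmetric bilinear form $\langle\cdot,\cdot\rangle$ on $A$ (fibrewise), satisfying for all sections $$\rho(X)\langle Y,Y\rangle=2\langle X,Y\circ Y\rangle,\qquad \rho(X)\langle Y,Y\rangle=2\langle X\circ Y,Y\rangle.\qquad ( * )$$ A $(1,1)$-tensor on $A$ is a vector bundle morphism $N:A\to A$ over the identity, also viewed as a $C^\infty(M)$-linear map on sections; $N^*$ is its adjoint, $\langle NX,Y\rangle=\langle X,N^*Y\rangle$, and $N^2$ is the composition of $N$ with itself. $N$ is orthogonal if $N+N^*=0$. The contracted product is $X\circ_N Y=N(X)\circ Y+X\circ N(Y)-N(X\circ Y)$, and the Nijenhuis torsion is $\mathrm{Tor}_N(X,Y)=N(X)\circ N(Y)-N(X\circ_N Y)$. $N$ is a Nijenhuis tensor if $\mathrm{Tor}_N=0$. $N$ is a Courant-Nijenhuis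 tensor if it is a Nijenhuis tensor and is compatible with the pairing, meaning that the identities $( * )$ hold with $\circ$ replaced by $\circ_N$ and $\rho$ replaced by $\rho_N=\rho\circ N$ (composition of bundle maps), with the same pairing. An orthogonal Courant-Nijenhuis tensor $N$ is called a complex Courant structure if $N^2=-I$, a product Courant structure if $N^2=I$, and a tangent Courant structure if $N^2=0$. A Courant algebroid is irreducible if the maps $\lambda I$, $\lambda\in\mathbb{R}$, are the only $(1,1)$-tensors $\Delta:A\to A$ satisfying $X\circ\Delta Z=\Delta(X\circ Z)$ and $\Delta(Y\circ Y)=(\Delta Y)\circ Y$ for all sections $X,Y,Z$. *)

theory Defs
  imports "HOL-Analysis.Analysis" "HOL-Library.Function_Algebras"
begin

section \<open>Function spaces as real vector spaces\<close>

instantiation "fun" :: (type, real_vector) real_vector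
begin

definition scaleR_fun :: "real \<Rightarrow> ('a \<Rightarrow> 'b) \<Rightarrow> 'a \<Rightarrow> 'b"
  where "scaleR_fun c f = (\<lambda>x. c *\<^sub>R f x)"

instance
  by standard (simp_all add: scaleR_fun_def fun_eq_iff scaleR_add_right scaleR_add_left)

end

definition linear_on :: "'a::real_vector set \<Rightarrow> ('a \<Rightarrow> 'b::real_vector) \<Rightarrow> bool"
  where "linear_on S f \<longleftrightarrow>
    (\<forall>u\<in>S. \<forall>v\<in>S. f (u + v) = f u + f v) \<and> (\<forall>c. \<forall>v\<in>S. f (c *\<^sub>R v) = c *\<^sub>R f v)"


section \<open>Smooth manifolds\<close>

text \<open>
  The space of real \<open>n\<close>-tuples is \<^const>\<open>Euclidean_space\<close>: sequences that vanish from index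
  \<open>n\<close> on, so that the dimension is a number and may be 0.
\<close>

definition partial_deriv :: "nat \<Rightarrow> ((nat \<Rightarrow> real) \<Rightarrow> real) \<Rightarrow> (nat \<Rightarrow> real) \<Rightarrow> real"
  where "partial_deriv i f x = deriv (\<lambda>t. f (x(i := t))) (x i)"

primrec Ck_on :: "nat \<Rightarrow> nat \<Rightarrow> (nat \<Rightarrow> real) set \<Rightarrow> ((nat \<Rightarrow> real) \<Rightarrow> real) \<Rightarrow> bool"
  where
    "Ck_on n 0 V f \<longleftrightarrow> continuous_map (subtopology (Euclidean_space n) V) euclideanreal f"
  | "Ck_on n (Suc k) V f \<longleftrightarrow>
      continuous_map (subtopology (Euclidean_space n) V) euclideanreal f \<and>
      (\<forall>i<n. (\<forall>x\<in>V. (\<lambda>t. f (x(i := t))) field_differentiable (at (x i))) \<and>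
             Ck_on n k V (partial_deriv i f))"

definition smooth_on :: "nat \<Rightarrow> (nat \<Rightarrow> real) set \<Rightarrow> ((nat \<Rightarrow> real) \<Rightarrow> real) \<Rightarrow> bool"
  where "smooth_on n V f \<longleftrightarrow> (\<forall>k. Ck_on n k V f)"

type_synonym 'm chart = "'m set \<times> ('m \<Rightarrow> nat \<Rightarrow> real)"

record 'm manifold =
  mtop :: "'m topology"
  mdim :: nat
  atlas :: "'m chart set"

abbreviation points :: "'m manifold \<Rightarrow> 'm set"
  where "points M \<equiv> topspace (mtop M)"

definition is_chart :: "'m topology \<Rightarrow> nat \<Rightarrow> 'm chart \<Rightarrow> bool"
  where "is_chart T n = (\<lambda>(U, \<phi>).
    openin T U \<and> openin (Euclidean_space n) (\<phi> ` U) \<and>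
    homeomorphic_map (subtopology T U) (subtopology (Euclidean_space n) (\<phi> ` U)) \<phi>)"

definition smooth_transition :: "nat \<Rightarrow> 'm chart \<Rightarrow> 'm chart \<Rightarrow> bool"
  where "smooth_transition n = (\<lambda>(U, \<phi>) (V, \<psi>).
    \<forall>i<n. smooth_on n (\<phi> ` (U \<inter> V)) (\<lambda>x. \<psi> (inv_into U \<phi> x) i))"

text \<open>The atlas is not required to be maximal.\<close>

definition smooth_manifold :: "'m manifold \<Rightarrow> bool"
  where "smooth_manifold M \<longleftrightarrow>
    Hausdorff_space (mtop M) \<and> second_countable (mtop M) \<and>
    (\<forall>c\<in>atlas M. is_chart (mtop M) (mdim M) c) \<and>
    (\<Union>(U, \<phi>)\<in>atlas M. U) = points M \<and>
    (\<forall>c\<in>atlas M. \<forall>d\<in>atlas M. smooth_transition (mdim M) c d)"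

definition smooth_fun_on :: "'m manifold \<Rightarrow> 'm set \<Rightarrow> ('m \<Rightarrow> real) \<Rightarrow> bool"
  where "smooth_fun_on M W f \<longleftrightarrow>
    (\<forall>(U, \<phi>)\<in>atlas M. smooth_on (mdim M) (\<phi> ` (U \<inter> W)) (\<lambda>x. f (inv_into U \<phi> x)))"


section \<open>Smooth vector bundles\<close>

text \<open>
  The fibres are linear subspaces of an ambient vector space \<open>'v\<close> that only serves to
  provide the operations: no topology on \<open>'v\<close> is used, and the smooth structure of the bundle is
  given by its local trivialisations \<open>(U, \<Phi>)\<close>, where \<open>\<Phi> p\<close> identifies the fibre at
  \<open>p \<in> U\<close> with the space of real \<open>r\<close>-tuples.
\<close>

record ('m, 'v) vbundle =
  fibre :: "'m \<Rightarrow> 'v set"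
  rank :: nat
  trivs :: "('m set \<times> ('m \<Rightarrow> 'v \<Rightarrow> nat \<Rightarrow> real)) set"

definition unit_tuple :: "nat \<Rightarrow> nat \<Rightarrow> real"
  where "unit_tuple i = (\<lambda>j. if j = i then 1 else 0)"

definition frame ::
  "('m, 'v, 'z) vbundle_scheme \<Rightarrow> ('m \<Rightarrow> 'v \<Rightarrow> nat \<Rightarrow> real) \<Rightarrow> nat \<Rightarrow> 'm \<Rightarrow> 'v"
  where "frame E \<Phi> i p = inv_into (fibre E p) (\<Phi> p) (unit_tuple i)"

definition vector_bundle :: "'m manifold \<Rightarrow> ('m, 'v::real_vector, 'z) vbundle_scheme \<Rightarrow> bool"
  where "vector_bundle M E \<longleftrightarrow>
    (\<forall>p\<in>points M. subspace (fibre E p)) \<and>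
    (\<forall>(U, \<Phi>)\<in>trivs E. openin (mtop M) U \<and>
       (\<forall>p\<in>U. linear_on (fibre E p) (\<Phi> p) \<and>
              bij_betw (\<Phi> p) (fibre E p) (topspace (Euclidean_space (rank E))))) \<and>
    (\<Union>(U, \<Phi>)\<in>trivs E. U) = points M \<and>
    (\<forall>(U, \<Phi>)\<in>trivs E. \<forall>(V, \<Psi>)\<in>trivs E. \<forall>i<rank E. \<forall>j<rank E.
       smooth_fun_on M (U \<inter> V) (\<lambda>p. \<Psi> p (frame E \<Phi> i p) j))"

text \<open>Sections are set to 0 outside the base, so that equality of sections is equality of functions.\<close>

definition sections :: "'m manifold \<Rightarrow> ('m, 'v::real_vector, 'z) vbundle_scheme \<Rightarrow> ('m \<Rightarrow> 'v) set"
  where "sections M E = {X.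
    (\<forall>p\<in>points M. X p \<in> fibre E p) \<and> (\<forall>p. p \<notin> points M \<longrightarrow> X p = 0) \<and>
    (\<forall>(U, \<Phi>)\<in>trivs E. \<forall>i<rank E. smooth_fun_on M U (\<lambda>p. \<Phi> p (X p) i))}"

text \<open>Vector bundle morphisms over the identity: fibrewise linear, with smooth matrix entries.\<close>

definition bundle_map ::
  "'m manifold \<Rightarrow> ('m, 'v::real_vector, 'y) vbundle_scheme \<Rightarrow> ('m, 'w::real_vector, 'z) vbundle_scheme
    \<Rightarrow> ('m \<Rightarrow> 'v \<Rightarrow> 'w) \<Rightarrow> bool"
  where "bundle_map M E F h \<longleftrightarrow>
    (\<forall>p\<in>points M. linear_on (fibre E p) (h p) \<and> h p ` fibre E p \<subseteq> fibre F p) \<and>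
    (\<forall>(U, \<Phi>)\<in>trivs E. \<forall>(V, \<Psi>)\<in>trivs F. \<forall>i<rank E. \<forall>j<rank F.
       smooth_fun_on M (U \<inter> V) (\<lambda>p. \<Psi> p (h p (frame E \<Phi> i p)) j))"

definition on_sections ::
  "'m manifold \<Rightarrow> ('m \<Rightarrow> 'v \<Rightarrow> 'w::real_vector) \<Rightarrow> ('m \<Rightarrow> 'v) \<Rightarrow> 'm \<Rightarrow> 'w"
  where "on_sections M h X = (\<lambda>p. if p \<in> points M then h p (X p) else 0)"


section \<open>The tangent bundle\<close>

text \<open>
  Tangent vectors at \<open>p\<close> are derivations at \<open>p\<close> on the functions that are smooth near \<open>p\<close>.
  Such a derivation depends only on germs: if \<open>f\<close> vanishes on an open neighbourhood \<open>W\<close> of \<open>p\<close>,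
  then \<open>f = f * g\<close> where \<open>g\<close> is the indicator function of the complement of \<open>W\<close>, which is smooth
  near \<open>p\<close> with \<open>g p = 0\<close>. The value 0 on all other functions makes the representation of
  a tangent vector unique.
\<close>

definition smooth_near :: "'m manifold \<Rightarrow> 'm \<Rightarrow> ('m \<Rightarrow> real) \<Rightarrow> bool"
  where "smooth_near M p f \<longleftrightarrow> (\<exists>W. openin (mtop M) W \<and> p \<in> W \<and> smooth_fun_on M W f)"

definition tangent_space :: "'m manifold \<Rightarrow> 'm \<Rightarrow> (('m \<Rightarrow> real) \<Rightarrow> real) set"
  where "tangent_space M p = {D.
    (\<forall>f g. smooth_near M p f \<longrightarrow> smooth_near M p g \<longrightarrow>
       D (f + g) = D f + D g \<and> D (f * g) = f p * D g + g p * D f) \<and>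
    (\<forall>c f. smooth_near M p f \<longrightarrow> D (c *\<^sub>R f) = c * D f) \<and>
    (\<forall>f. \<not> smooth_near M p f \<longrightarrow> D f = 0)}"

definition tangent_bundle :: "'m manifold \<Rightarrow> ('m, ('m \<Rightarrow> real) \<Rightarrow> real) vbundle"
  where "tangent_bundle M =
    \<lparr> fibre = tangent_space M,
      rank = mdim M,
      trivs = {(U, \<lambda>p D j. D (\<lambda>q. \<phi> q j)) | U \<phi>. (U, \<phi>) \<in> atlas M} \<rparr>"


section \<open>Courant algebroids\<close>

record ('m, 'v) courant = "('m, 'v) vbundle" +
  bracket :: "('m \<Rightarrow> 'v) \<Rightarrow> ('m \<Rightarrow> 'v) \<Rightarrow> 'm \<Rightarrow> 'v"
  anchor :: "'m \<Rightarrow> 'v \<Rightarrow> ('m \<Rightarrow> real) \<Rightarrow> real"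
  pairing :: "'m \<Rightarrow> 'v \<Rightarrow> 'v \<Rightarrow> real"

definition pair_sections ::
  "'m manifold \<Rightarrow> ('m, 'v::real_vector) courant \<Rightarrow> ('m \<Rightarrow> 'v) \<Rightarrow> ('m \<Rightarrow> 'v) \<Rightarrow> 'm \<Rightarrow> real"
  where "pair_sections M A X Y = (\<lambda>p. if p \<in> points M then pairing A p (X p) (Y p) else 0)"

definition nondegenerate_pairing :: "'m manifold \<Rightarrow> ('m, 'v::real_vector) courant \<Rightarrow> bool"
  where "nondegenerate_pairing M A \<longleftrightarrow>
    (\<forall>p\<in>points M.
       (\<forall>v\<in>fibre A p. linear_on (fibre A p) (pairing A p v)) \<and>
       (\<forall>v\<in>fibre A p. \<forall>w\<in>fibre A p. pairing A p v w = pairing A p w v) \<and>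
       (\<forall>v\<in>fibre A p. (\<forall>w\<in>fibre A p. pairing A p v w = 0) \<longrightarrow> v = 0)) \<and>
    (\<forall>(U, \<Phi>)\<in>trivs A. \<forall>i<rank A. \<forall>j<rank A.
       smooth_fun_on M U (\<lambda>p. pairing A p (frame A \<Phi> i p) (frame A \<Phi> j p)))"

definition bilinear_product ::
  "'m manifold \<Rightarrow> ('m, 'v::real_vector) courant
    \<Rightarrow> (('m \<Rightarrow> 'v) \<Rightarrow> ('m \<Rightarrow> 'v) \<Rightarrow> 'm \<Rightarrow> 'v) \<Rightarrow> bool"
  where "bilinear_product M A b \<longleftrightarrow>
    (\<forall>X\<in>sections M A. \<forall>Y\<in>sections M A. b X Y \<in> sections M A) \<and>
    (\<forall>X\<in>sections M A. linear_on (sections M A) (b X)) \<and>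
    (\<forall>Y\<in>sections M A. linear_on (sections M A) (\<lambda>X. b X Y))"

definition leibniz_product ::
  "'m manifold \<Rightarrow> ('m, 'v::real_vector) courant
    \<Rightarrow> (('m \<Rightarrow> 'v) \<Rightarrow> ('m \<Rightarrow> 'v) \<Rightarrow> 'm \<Rightarrow> 'v) \<Rightarrow> bool"
  where "leibniz_product M A b \<longleftrightarrow>
    (\<forall>X\<in>sections M A. \<forall>Y\<in>sections M A. \<forall>Z\<in>sections M A.
       b (b X Y) Z = b X (b Y Z) - b Y (b X Z))"

text \<open>
  The compatibility identities, for an arbitrary product \<open>b\<close> and anchor \<open>\<rho>\<close>
  and the pairing of \<open>A\<close>.
\<close>

definition pairing_identities ::
  "'m manifold \<Rightarrow> ('m, 'v::real_vector) courant
    \<Rightarrow> (('m \<Rightarrow> 'v) \<Rightarrow> ('m \<Rightarrow> 'v) \<Rightarrow> 'm \<Rightarrow> 'v) \<Rightarrow> ('m \<Rightarrow> 'v \<Rightarrow> ('m \<Rightarrow> real) \<Rightarrow> real) \<Rightarrow> bool"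
  where "pairing_identities M A b \<rho> \<longleftrightarrow>
    (\<forall>X\<in>sections M A. \<forall>Y\<in>sections M A. \<forall>p\<in>points M.
       \<rho> p (X p) (pair_sections M A Y Y) = 2 * pair_sections M A X (b Y Y) p \<and>
       \<rho> p (X p) (pair_sections M A Y Y) = 2 * pair_sections M A (b X Y) Y p)"

definition courant_algebroid :: "'m manifold \<Rightarrow> ('m, 'v::real_vector) courant \<Rightarrow> bool"
  where "courant_algebroid M A \<longleftrightarrow>
    smooth_manifold M \<and> vector_bundle M A \<and>
    bilinear_product M A (bracket A) \<and> leibniz_product M A (bracket A) \<and>
    bundle_map M A (tangent_bundle M) (anchor A) \<and>
    nondegenerate_pairing M A \<and>
    pairing_identities M A (bracket A) (anchor A)"


section \<open>Courant-Nijenhuis tensors\<close>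

definition tensor11 :: "'m manifold \<Rightarrow> ('m, 'v::real_vector) courant \<Rightarrow> ('m \<Rightarrow> 'v \<Rightarrow> 'v) \<Rightarrow> bool"
  where "tensor11 M A N \<longleftrightarrow> bundle_map M A A N"

definition tensor_eq ::
  "'m manifold \<Rightarrow> ('m, 'v::real_vector) courant \<Rightarrow> ('m \<Rightarrow> 'v \<Rightarrow> 'v) \<Rightarrow> ('m \<Rightarrow> 'v \<Rightarrow> 'v) \<Rightarrow> bool"
  where "tensor_eq M A N N' \<longleftrightarrow> (\<forall>p\<in>points M. \<forall>v\<in>fibre A p. N p v = N' p v)"

definition tensor_square :: "('m \<Rightarrow> 'v \<Rightarrow> 'v) \<Rightarrow> 'm \<Rightarrow> 'v \<Rightarrow> 'v"
  where "tensor_square N = (\<lambda>p v. N p (N p v))"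

definition scalar_tensor :: "real \<Rightarrow> 'm \<Rightarrow> 'v::real_vector \<Rightarrow> 'v"
  where "scalar_tensor c = (\<lambda>p v. c *\<^sub>R v)"

definition is_adjoint ::
  "'m manifold \<Rightarrow> ('m, 'v::real_vector) courant \<Rightarrow> ('m \<Rightarrow> 'v \<Rightarrow> 'v) \<Rightarrow> ('m \<Rightarrow> 'v \<Rightarrow> 'v) \<Rightarrow> bool"
  where "is_adjoint M A N N' \<longleftrightarrow> tensor11 M A N' \<and>
    (\<forall>p\<in>points M. \<forall>v\<in>fibre A p. \<forall>w\<in>fibre A p. pairing A p (N p v) w = pairing A p v (N' p w))"

text \<open>The adjoint is unique on the fibres because the pairing is nondegenerate.\<close>

definition orthogonal_tensor ::
  "'m manifold \<Rightarrow> ('m, 'v::real_vector) courant \<Rightarrow> ('m \<Rightarrow> 'v \<Rightarrow> 'v) \<Rightarrow> bool"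
  where "orthogonal_tensor M A N \<longleftrightarrow>
    (\<exists>N'. is_adjoint M A N N' \<and> tensor_eq M A (N + N') (scalar_tensor 0))"

definition contracted ::
  "'m manifold \<Rightarrow> ('m, 'v::real_vector) courant \<Rightarrow> ('m \<Rightarrow> 'v \<Rightarrow> 'v)
    \<Rightarrow> ('m \<Rightarrow> 'v) \<Rightarrow> ('m \<Rightarrow> 'v) \<Rightarrow> 'm \<Rightarrow> 'v"
  where "contracted M A N X Y =
    bracket A (on_sections M N X) Y + bracket A X (on_sections M N Y)
      - on_sections M N (bracket A X Y)"

definition torsion ::
  "'m manifold \<Rightarrow> ('m, 'v::real_vector) courant \<Rightarrow> ('m \<Rightarrow> 'v \<Rightarrow> 'v)
    \<Rightarrow> ('m \<Rightarrow> 'v) \<Rightarrow> ('m \<Rightarrow> 'v) \<Rightarrow> 'm \<Rightarrow> 'v"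
  where "torsion M A N X Y =
    bracket A (on_sections M N X) (on_sections M N Y) - on_sections M N (contracted M A N X Y)"

definition nijenhuis_tensor ::
  "'m manifold \<Rightarrow> ('m, 'v::real_vector) courant \<Rightarrow> ('m \<Rightarrow> 'v \<Rightarrow> 'v) \<Rightarrow> bool"
  where "nijenhuis_tensor M A N \<longleftrightarrow> tensor11 M A N \<and>
    (\<forall>X\<in>sections M A. \<forall>Y\<in>sections M A. torsion M A N X Y = 0)"

definition courant_nijenhuis ::
  "'m manifold \<Rightarrow> ('m, 'v::real_vector) courant \<Rightarrow> ('m \<Rightarrow> 'v \<Rightarrow> 'v) \<Rightarrow> bool"
  where "courant_nijenhuis M A N \<longleftrightarrow> nijenhuis_tensor M A N \<and>
    pairing_identities M A (contracted M A N) (\<lambda>p v. anchor A p (N p v))"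

definition orthogonal_courant_nijenhuis ::
  "'m manifold \<Rightarrow> ('m, 'v::real_vector) courant \<Rightarrow> ('m \<Rightarrow> 'v \<Rightarrow> 'v) \<Rightarrow> bool"
  where "orthogonal_courant_nijenhuis M A N \<longleftrightarrow>
    courant_nijenhuis M A N \<and> orthogonal_tensor M A N"

definition complex_courant_structure ::
  "'m manifold \<Rightarrow> ('m, 'v::real_vector) courant \<Rightarrow> ('m \<Rightarrow> 'v \<Rightarrow> 'v) \<Rightarrow> bool"
  where "complex_courant_structure M A N \<longleftrightarrow> orthogonal_courant_nijenhuis M A N \<and>
    tensor_eq M A (tensor_square N) (scalar_tensor (-1))"

definition product_courant_structure ::
  "'m manifold \<Rightarrow> ('m, 'v::real_vector) courant \<Rightarrow> ('m \<Rightarrow> 'v \<Rightarrow> 'v) \<Rightarrow> bool"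
  where "product_courant_structure M A N \<longleftrightarrow> orthogonal_courant_nijenhuis M A N \<and>
    tensor_eq M A (tensor_square N) (scalar_tensor 1)"

definition tangent_courant_structure ::
  "'m manifold \<Rightarrow> ('m, 'v::real_vector) courant \<Rightarrow> ('m \<Rightarrow> 'v \<Rightarrow> 'v) \<Rightarrow> bool"
  where "tangent_courant_structure M A N \<longleftrightarrow> orthogonal_courant_nijenhuis M A N \<and>
    tensor_eq M A (tensor_square N) (scalar_tensor 0)"

definition irreducible_courant_algebroid ::
  "'m manifold \<Rightarrow> ('m, 'v::real_vector) courant \<Rightarrow> bool"
  where "irreducible_courant_algebroid M A \<longleftrightarrow> courant_algebroid M A \<and>
    (\<forall>\<Delta>. tensor11 M A \<Delta> \<longrightarrow>
       (\<forall>X\<in>sections M A. \<forall>Y\<in>sections M A. \<forall>Z\<in>sections M A.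
          bracket A X (on_sections M \<Delta> Z) = on_sections M \<Delta> (bracket A X Z) \<and>
          on_sections M \<Delta> (bracket A Y Y) = bracket A (on_sections M \<Delta> Y) Y) \<longrightarrow>
       (\<exists>c. tensor_eq M A \<Delta> (scalar_tensor c)))"

end

(*
  Write L_X for the operator Y \<mapsto> X \<circ> Y and D_X = [L_X, N]. Since L_X is skew up to the derivation
  \<rho>(X), and N is skew, the compatibility of N with the pairing says that D_X is skew and that
  NY \<circ> Y + Y \<circ> NY = 0. Vanishing torsion reads D_{NX} = N D_X; comparing adjoints of the two sides,
  N D_X = - D_X N, that is [L_X, N^2] = 0. Polarising the second identity with NY and using
  Tor_N(Y, Y) = 0 gives N^2(Y \<circ> Y) = (N^2 Y) \<circ> Y. By irreducibility N^2 is a constant multiple of the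
  identity, and N is rescaled.

  Identities of sections are obtained from the nondegeneracy of the pairing on the fibres, so every
  vector has to extend to a global section; this is where bump functions enter.
*)
theory Submission
  imports Defs
begin

section \<open>Functions of class \<open>C\<^sup>k\<close>\<close>

text \<open>The anchor never has to be handled as a derivation. Since \<rho>_N(X) = \<rho>(NX), the
  original identities for NX and the identities of the contracted product for X evaluate the same
  function \<rho>(NX)<Y,Y>. Equating the values removes \<rho> and leaves relations between the
  product, N and the pairing alone, on which a purely algebraic argument can run. That argument
  lives on the space of all sections, because the product is given only there and is only
  R-bilinear, whereas nondegeneracy is a statement about single fibres. Passing between the two
  levels accounts for most of the length. Smoothness being a condition on iterated partial
  derivatives in charts, the bump function is assembled from constants, coordinates, sums, products
  and one flat function, and closure of the smooth functions is established for exactly these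
  operations.\<close>

text \<open>Partial derivatives are one-variable derivatives along t \<mapsto>
  \<open>x(i := t)\<close>, so open sets matter through their traces on these lines. The bound
  \<open>i < n\<close> keeps the line inside \<open>Euclidean_space n\<close>, where all later
  coordinates vanish.\<close>

lemma openin_line:
  assumes "openin (Euclidean_space n) V" "x \<in> V" "i < n"
  shows "eventually (\<lambda>t. x(i := t) \<in> V) (nhds (x i))"
proof -
  have x: "x \<in> topspace (Euclidean_space n)"
    using assms openin_subset by blast
  have "continuous_map euclideanreal (powertop_real UNIV) (\<lambda>t. x(i := t))"
    by (auto simp: continuous_map_componentwise_UNIV fun_upd_def intro!: continuous_intros)
  then have "continuous_map euclideanreal (Euclidean_space n) (\<lambda>t. x(i := t))"
    using x assms(3)
    unfolding Euclidean_space_def continuous_map_in_subtopology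
    by auto
  then have "open {t. x(i := t) \<in> V}"
    using assms(1) openin_continuous_map_preimage by fastforce
  then show ?thesis
    unfolding eventually_nhds using assms(2) by (intro exI[of _ "{t. x(i := t) \<in> V}"]) auto
qed

lemma eventually_eq_line:
  assumes "openin (Euclidean_space n) V" "x \<in> V" "i < n" "\<And>y. y \<in> V \<Longrightarrow> f y = g y"
  shows "eventually (\<lambda>t. f (x(i := t)) = g (x(i := t))) (nhds (x i))"
  using openin_line[OF assms(1-3)] by (rule eventually_mono) (use assms(4) in auto)

text \<open>Functions are total and \<open>partial_deriv\<close> may look outside \<open>V\<close>,
  but at points of an open set it sees only germs along lines. This lets the closure lemmas below
  replace a partial derivative by the formula valid on \<open>V\<close>.\<close>

lemma Ck_on_cong:
  assumes "openin (Euclidean_space n) V" "Ck_on n k V f" "\<And>y. y \<in> V \<Longrightarrow> f y = g y"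
  shows "Ck_on n k V g"
  using assms(2,3)
proof (induction k arbitrary: f g)
  case 0
  then show ?case by (auto intro: continuous_map_eq)
next
  case (Suc k)
  have "(\<lambda>t. g (x(i := t))) field_differentiable at (x i)"
    "partial_deriv i f x = partial_deriv i g x" if "i < n" "x \<in> V" for i x
  proof -
    have ev: "eventually (\<lambda>t. f (x(i := t)) = g (x(i := t))) (nhds (x i))"
      using eventually_eq_line[OF assms(1) that(2,1) Suc.prems(2)] .
    show "partial_deriv i f x = partial_deriv i g x"
      unfolding partial_deriv_def using ev by (rule deriv_cong_ev) simp
    have "(\<lambda>t. f (x(i := t))) field_differentiable at (x i)"
      using Suc.prems(1) that by auto
    then show "(\<lambda>t. g (x(i := t))) field_differentiable at (x i)"
      unfolding field_differentiable_def using DERIV_cong_ev[OF refl ev refl] by blast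
  qed
  then show ?case
    using Suc.prems Suc.IH by (auto intro: continuous_map_eq)
qed

lemma Ck_on_subset:
  assumes "Ck_on n k V f" "W \<subseteq> V"
  shows "Ck_on n k W f"
  using assms(1)
proof (induction k arbitrary: f)
  case 0
  then show ?case using assms(2) continuous_map_from_subtopology_mono by auto
next
  case (Suc k)
  then show ?case using assms(2) continuous_map_from_subtopology_mono by auto
qed

lemma continuous_map_on_Union:
  assumes "\<And>V. V \<in> \<V> \<Longrightarrow> openin T V"
    and "\<And>V. V \<in> \<V> \<Longrightarrow> continuous_map (subtopology T V) T' f"
  shows "continuous_map (subtopology T (\<Union>\<V>)) T' f"
proof (rule pasting_lemma[where I = \<V> and T = "\<lambda>V. V" and f = "\<lambda>_. f"])
  fix V assume V: "V \<in> \<V>"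
  then have "V \<subseteq> \<Union>\<V>" by blast
  then show "openin (subtopology T (\<Union>\<V>)) V"
    using assms(1)[OF V] openin_subset_topspace_eq openin_subtopology by blast
  have "\<Union>\<V> \<inter> V = V" using V by blast
  then show "continuous_map (subtopology (subtopology T (\<Union>\<V>)) V) T' f"
    using assms(2)[OF V] by (simp add: subtopology_subtopology)
qed auto

text \<open>Differentiability is tested point by point and \<open>partial_deriv\<close> does not
  depend on the set, so only continuity has to be glued; openness serves that gluing.\<close>

lemma Ck_on_Union:
  assumes "\<And>V. V \<in> \<V> \<Longrightarrow> openin (Euclidean_space n) V" "\<And>V. V \<in> \<V> \<Longrightarrow> Ck_on n k V f"
  shows "Ck_on n k (\<Union>\<V>) f"
  using assms(2)
proof (induction k arbitrary: f)
  case 0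
  show ?case
    unfolding Ck_on.simps
    by (rule continuous_map_on_Union[OF assms(1)]) (use 0 in auto)
next
  case (Suc k)
  then have "Ck_on n k (\<Union>\<V>) (partial_deriv i f)" if "i < n" for i
    using that by simp
  moreover have "continuous_map (subtopology (Euclidean_space n) (\<Union>\<V>)) euclideanreal f"
    by (rule continuous_map_on_Union[OF assms(1)]) (use Suc.prems in auto)
  ultimately show ?case using Suc.prems by auto
qed

lemma Ck_on_Suc_imp: "Ck_on n (Suc k) V f \<Longrightarrow> Ck_on n k V f"
  by (induction k arbitrary: f) auto

lemma Ck_on_const: "Ck_on n k V (\<lambda>_. c)"
proof (induction k arbitrary: c)
  case (Suc k)
  have "partial_deriv i (\<lambda>_. c) = (\<lambda>_. 0)" for i
    by (simp add: partial_deriv_def fun_eq_iff)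
  then show ?case using Suc by simp
qed simp

lemma Ck_on_add:
  assumes "openin (Euclidean_space n) V"
  shows "Ck_on n k V f \<Longrightarrow> Ck_on n k V g \<Longrightarrow> Ck_on n k V (\<lambda>x. f x + g x)"
proof (induction k arbitrary: f g)
  case 0
  then show ?case by (auto intro: continuous_intros)
next
  case (Suc k)
  have "Ck_on n k V (partial_deriv i (\<lambda>x. f x + g x))" if "i < n" for i
  proof (rule Ck_on_cong[OF assms])
    show "Ck_on n k V (\<lambda>x. partial_deriv i f x + partial_deriv i g x)"
      using Suc that by auto
    show "partial_deriv i f x + partial_deriv i g x = partial_deriv i (\<lambda>x. f x + g x) x"
      if "x \<in> V" for x
      unfolding partial_deriv_def
      by (subst deriv_add) (use Suc that \<open>i < n\<close> in auto)
  qed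
  then show ?case using Suc.prems by (auto intro!: continuous_intros field_differentiable_add)
qed

lemma Ck_on_mult:
  assumes "openin (Euclidean_space n) V"
  shows "Ck_on n k V f \<Longrightarrow> Ck_on n k V g \<Longrightarrow> Ck_on n k V (\<lambda>x. f x * g x)"
proof (induction k arbitrary: f g)
  case 0
  then show ?case by (auto intro: continuous_intros)
next
  case (Suc k)
  have "Ck_on n k V (partial_deriv i (\<lambda>x. f x * g x))" if i: "i < n" for i
  proof (rule Ck_on_cong[OF assms])
    \<comment> \<open>The product rule keeps one factor undifferentiated; that factor enters the
      induction hypothesis with one order of smoothness dropped.\<close>
    show "Ck_on n k V (\<lambda>x. f x * partial_deriv i g x + partial_deriv i f x * g x)"
      using Suc.prems i Ck_on_Suc_imp[OF Suc.prems(1)] Ck_on_Suc_imp[OF Suc.prems(2)]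
      by (intro Ck_on_add[OF assms] Suc.IH) auto
    show "f x * partial_deriv i g x + partial_deriv i f x * g x = partial_deriv i (\<lambda>x. f x * g x) x"
      if "x \<in> V" for x
      unfolding partial_deriv_def
      by (subst deriv_mult) (use Suc that i in auto)
  qed
  then show ?case using Suc.prems by (auto intro!: continuous_intros field_differentiable_mult)
qed

text \<open>
  The flat functions at 0. The exponent \<open>m\<close> makes the family closed under differentiation up to
  linear combinations, so smoothness of compositions follows by induction for all \<open>m\<close> at once.
\<close>

definition flat :: "nat \<Rightarrow> real \<Rightarrow> real"
  where "flat m t = (if t > 0 then (1 / t) ^ m * exp (- (1 / t)) else 0)"

lemma flat_pos: "0 < t \<Longrightarrow> 0 < flat m t"
  by (simp add: flat_def)

text \<open>With u = 1/t this is the limit of u^m / exp u at infinity.\<close>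

lemma flat_tendsto_0: "(flat m \<longlongrightarrow> 0) (at_right 0)"
proof -
  have "((\<lambda>t. (1 / t) ^ m / exp (1 / t)) \<longlongrightarrow> 0) (at_right (0::real))"
    using filterlim_compose[OF tendsto_power_div_exp_0 filterlim_inverse_at_top_right, of m]
    by (simp add: inverse_eq_divide)
  moreover have "eventually (\<lambda>t. (1 / t) ^ m / exp (1 / t) = flat m t) (at_right (0::real))"
    unfolding eventually_at_right_field by (intro exI[of _ 1]) (auto simp: flat_def exp_minus field_simps)
  ultimately show ?thesis by (rule Lim_transform_eventually)
qed

lemma flat_has_derivative:
  "(flat m has_field_derivative (flat (m + 2) t - real m * flat (m + 1) t)) (at t)"
proof (cases t "0::real" rule: linorder_cases)
  case less
  then have "eventually (\<lambda>s. flat m s = 0) (nhds t)"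
    unfolding eventually_nhds by (intro exI[of _ "{..<0}"]) (auto simp: flat_def)
  from DERIV_cong_ev[OF refl this refl] have "(flat m has_field_derivative 0) (at t)"
    by simp
  then show ?thesis using less by (simp add: flat_def)
next
  case equal
  have "((\<lambda>h. flat m h / h) \<longlongrightarrow> 0) (at 0)"
    unfolding filterlim_at_split
  proof
    show "((\<lambda>h. flat m h / h) \<longlongrightarrow> 0) (at_left 0)"
      by (rule Lim_transform_eventually[OF tendsto_const])
        (auto simp: eventually_at_left_field flat_def intro!: exI[of _ "-1"])
    \<comment> \<open>For h > 0 the difference quotient \<open>flat m h / h\<close> equals
      \<open>flat (Suc m) h\<close>: dividing by h only raises the exponent.\<close>
    show "((\<lambda>h. flat m h / h) \<longlongrightarrow> 0) (at_right 0)"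
      by (rule Lim_transform_eventually[OF flat_tendsto_0[of "Suc m"]])
        (auto simp: eventually_at_right_field flat_def intro!: exI[of _ 1])
  qed
  then show ?thesis using equal by (simp add: has_field_derivative_iff flat_def)
next
  case greater
  then have ev: "eventually (\<lambda>s. flat m s = (1 / s) ^ m * exp (- (1 / s))) (nhds t)"
    unfolding eventually_nhds by (intro exI[of _ "{0<..}"]) (auto simp: flat_def)
  define u where "u = 1 / t"
  have "((\<lambda>s. 1 / s) has_field_derivative - (u ^ 2)) (at t)"
    using greater by (auto intro!: derivative_eq_intros simp: u_def power2_eq_square)
  moreover have "((\<lambda>u. u ^ m * exp (- u)) has_field_derivative
      real m * u ^ (m - 1) * exp (- u) - u ^ m * exp (- u)) (at u)"
    by (auto intro!: derivative_eq_intros)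
  ultimately have "((\<lambda>s. (1 / s) ^ m * exp (- (1 / s))) has_field_derivative
      (real m * u ^ (m - 1) * exp (- u) - u ^ m * exp (- u)) * - (u ^ 2)) (at t)"
    unfolding u_def
    by (rule DERIV_chain'[where g = "\<lambda>u. u ^ m * exp (- u)" and f = "\<lambda>s. 1 / s"])
  \<comment> \<open>The case split on \<open>m\<close> is due to truncated subtraction: for
    \<open>m = 0\<close> the exponent \<open>m - 1\<close> is 0, but the coefficient
    \<open>real m\<close> removes that term.\<close>
  moreover have "(real m * u ^ (m - 1) * exp (- u) - u ^ m * exp (- u)) * - (u ^ 2) =
      flat (m + 2) t - real m * flat (m + 1) t"
    using greater by (cases m) (auto simp: flat_def u_def[symmetric] algebra_simps power2_eq_square)
  ultimately have "((\<lambda>s. (1 / s) ^ m * exp (- (1 / s))) has_field_derivative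
      flat (m + 2) t - real m * flat (m + 1) t) (at t)"
    by metis
  then show ?thesis using DERIV_cong_ev[OF refl ev refl] by blast
qed

lemma continuous_map_flat:
  assumes "continuous_map T euclideanreal f"
  shows "continuous_map T euclideanreal (\<lambda>x. flat m (f x))"
proof -
  have "continuous_map euclideanreal euclideanreal (flat m)"
    using flat_has_derivative DERIV_isCont by (simp add: continuous_on_eq_continuous_at) blast
  from continuous_map_compose[OF assms this] show ?thesis by (simp add: o_def)
qed

lemma Ck_on_flat:
  assumes "openin (Euclidean_space n) V"
  shows "Ck_on n k V f \<Longrightarrow> Ck_on n k V (\<lambda>x. flat m (f x))"
proof (induction k arbitrary: m)
  case 0
  then show ?case by (simp add: continuous_map_flat)
next
  case (Suc k)
  have D: "((\<lambda>t. flat m (f (x(i := t)))) has_field_derivative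
      (flat (m + 2) (f x) - real m * flat (m + 1) (f x)) * partial_deriv i f x) (at (x i))"
    if "i < n" "x \<in> V" for i x
  proof -
    have "((\<lambda>t. f (x(i := t))) has_field_derivative partial_deriv i f x) (at (x i))"
      using Suc.prems that field_differentiable_derivI unfolding partial_deriv_def by auto
    then show ?thesis
      by (rule DERIV_chain'[where g = "flat m"]) (use flat_has_derivative[of m "f x"] in simp)
  qed
  have "Ck_on n k V (partial_deriv i (\<lambda>x. flat m (f x)))" if i: "i < n" for i
  proof (rule Ck_on_cong[OF assms])
    have "Ck_on n k V (\<lambda>x. flat (m + 2) (f x) + (- real m) * flat (m + 1) (f x))"
      using Ck_on_Suc_imp[OF Suc.prems]
      by (intro Ck_on_add[OF assms] Ck_on_mult[OF assms] Suc.IH Ck_on_const)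
    then show "Ck_on n k V (\<lambda>x. (flat (m + 2) (f x) + (- real m) * flat (m + 1) (f x))
        * partial_deriv i f x)"
      using Suc.prems i by (intro Ck_on_mult[OF assms]) auto
    show "(flat (m + 2) (f x) + (- real m) * flat (m + 1) (f x)) * partial_deriv i f x =
        partial_deriv i (\<lambda>x. flat m (f x)) x" if "x \<in> V" for x
      using DERIV_imp_deriv[OF D[OF i that]] by (simp add: partial_deriv_def)
  qed
  moreover have "(\<lambda>t. flat m (f (x(i := t)))) field_differentiable at (x i)"
    if "i < n" "x \<in> V" for i x
    using D[OF that] field_differentiable_def by blast
  ultimately show ?case using Suc.prems by (auto intro: continuous_map_flat)
qed

section \<open>Bump functions on manifolds\<close>

text \<open>A basic neighbourhood in the product topology is a product of open sets. From index
  \<open>n\<close> on, every point of the box agrees with \<open>x\<close>, so only the first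
  \<open>n\<close> radii have to be bounded below.\<close>

lemma ball_box_subset_open:
  assumes "openin (Euclidean_space n) V" "x \<in> V"
  obtains \<delta> where "\<delta> > 0" "{y. (\<forall>i<n. \<bar>y i - x i\<bar> \<le> \<delta>) \<and> (\<forall>i\<ge>n. y i = 0)} \<subseteq> V"
proof -
  have x0: "x i = 0" if "i \<ge> n" for i
    using assms openin_subset topspace_Euclidean_space that by blast
  obtain S where S: "openin (powertop_real UNIV) S" "V = S \<inter> {y. \<forall>i\<ge>n. y i = 0}"
    using assms(1) by (auto simp: Euclidean_space_def openin_subtopology)
  then obtain W where W: "\<And>i. open (W i)" "x \<in> PiE UNIV W" "PiE UNIV W \<subseteq> S"
    using assms(2) unfolding openin_product_topology_alt by fastforce
  have "\<exists>d>0. cball (x i) d \<subseteq> W i" for i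
    using W open_contains_cball by blast
  then obtain d where d: "\<And>i. d i > 0" "\<And>i. cball (x i) (d i) \<subseteq> W i"
    by metis
  \<comment> \<open>The extra element 1 keeps the minimum meaningful for
    \<open>n = 0\<close>.\<close>
  define \<delta> where "\<delta> = Min (insert 1 (d ` {..<n}))"
  have "\<delta> > 0" using d by (auto simp: \<delta>_def)
  have le: "\<delta> \<le> d i" if "i < n" for i
    unfolding \<delta>_def using that by (intro Min_le) auto
  have "y \<in> V" if y: "\<forall>i<n. \<bar>y i - x i\<bar> \<le> \<delta>" "\<forall>i\<ge>n. y i = 0" for y
  proof -
    have "y i \<in> W i" for i
    proof (cases "i < n")
      case True
      then have "y i \<in> cball (x i) (d i)"
        using y le[OF True] by (force simp: dist_real_def)
      then show ?thesis using d by blast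
    next
      case False
      then have "y i = x i" using y x0 by simp
      then show ?thesis using W(2) by auto
    qed
    then show ?thesis using W(3) S(2) y by auto
  qed
  then show thesis using that[OF \<open>\<delta> > 0\<close>] by blast
qed

text \<open>By Tychonoff: the box is a product of intervals, and of the singleton {0} from index
  \<open>n\<close> on. Its compactness is what will make the support region of a bump function
  closed in the manifold.\<close>

lemma compactin_box:
  "compactin (Euclidean_space n) {y. (\<forall>i<n. \<bar>y i - x i\<bar> \<le> \<delta>) \<and> (\<forall>i\<ge>n. y i = 0)}"
    (is "compactin _ ?B")
proof -
  have "?B = PiE UNIV (\<lambda>i. if i < n then {x i - \<delta>..x i + \<delta>} else {0})"
  proof (intro set_eqI iffI)
    fix y assume "y \<in> ?B"
    then show "y \<in> PiE UNIV (\<lambda>i. if i < n then {x i - \<delta>..x i + \<delta>} else {0})"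
      by (auto simp: PiE_iff abs_le_iff algebra_simps)
  next
    fix y assume y: "y \<in> PiE UNIV (\<lambda>i. if i < n then {x i - \<delta>..x i + \<delta>} else {0})"
    have *: "y i \<in> (if i < n then {x i - \<delta>..x i + \<delta>} else {0})" for i
      using y by (auto simp: PiE_iff)
    have "\<bar>y i - x i\<bar> \<le> \<delta>" if "i < n" for i
      using *[of i] that by (auto simp: abs_le_iff)
    moreover have "y i = 0" if "i \<ge> n" for i
      using *[of i] that by auto
    ultimately show "y \<in> ?B" by blast
  qed
  moreover have "compactin (powertop_real UNIV) (PiE UNIV (\<lambda>i. if i < n then {x i - \<delta>..x i + \<delta>} else {0}))"
    by (subst compactin_PiE) auto
  ultimately show ?thesis
    by (auto simp: Euclidean_space_def compactin_subtopology)
qed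

context
  fixes M :: "'m manifold"
  assumes M: "smooth_manifold M"
begin

lemma chart_props:
  assumes "(U, \<phi>) \<in> atlas M"
  shows "openin (mtop M) U" "openin (Euclidean_space (mdim M)) (\<phi> ` U)" "inj_on \<phi> U"
    "homeomorphic_map (subtopology (mtop M) U) (subtopology (Euclidean_space (mdim M)) (\<phi> ` U)) \<phi>"
proof -
  show *: "openin (mtop M) U" "openin (Euclidean_space (mdim M)) (\<phi> ` U)"
    "homeomorphic_map (subtopology (mtop M) U) (subtopology (Euclidean_space (mdim M)) (\<phi> ` U)) \<phi>"
    using M assms unfolding smooth_manifold_def is_chart_def by fast+
  then show "inj_on \<phi> U"
    using homeomorphic_imp_injective_map[OF *(3)] openin_subset[OF *(1)]
    by (simp add: Int_absorb1)
qed

lemma openin_chart_image: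
  assumes "(U, \<phi>) \<in> atlas M" "openin (mtop M) W"
  shows "openin (Euclidean_space (mdim M)) (\<phi> ` (U \<inter> W))"
proof -
  note c = chart_props[OF assms(1)]
  have "openin (subtopology (mtop M) U) (U \<inter> W)"
    using assms(2) by (rule openin_subtopology_Int2)
  then have "openin (subtopology (Euclidean_space (mdim M)) (\<phi> ` U)) (\<phi> ` (U \<inter> W))"
    using homeomorphic_imp_open_map[OF c(4)] unfolding open_map_def by blast
  then show ?thesis using c(2) openin_trans_full by blast
qed

section \<open>Smooth functions: locality and closure properties\<close>

lemma smooth_fun_on_cong:
  assumes "openin (mtop M) W" "smooth_fun_on M W f" "\<And>q. q \<in> W \<Longrightarrow> f q = g q"
  shows "smooth_fun_on M W g"
  unfolding smooth_fun_on_def smooth_on_def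
proof (clarify)
  fix U \<phi> k assume c: "(U, \<phi>) \<in> atlas M"
  show "Ck_on (mdim M) k (\<phi> ` (U \<inter> W)) (\<lambda>x. g (inv_into U \<phi> x))"
  proof (rule Ck_on_cong[OF openin_chart_image[OF c assms(1)]])
    show "Ck_on (mdim M) k (\<phi> ` (U \<inter> W)) (\<lambda>x. f (inv_into U \<phi> x))"
      using assms(2) c unfolding smooth_fun_on_def smooth_on_def by fast
    show "f (inv_into U \<phi> x) = g (inv_into U \<phi> x)" if "x \<in> \<phi> ` (U \<inter> W)" for x
      using that assms(3) chart_props(3)[OF c] by auto
  qed
qed

lemma smooth_fun_on_subset: "smooth_fun_on M W f \<Longrightarrow> W' \<subseteq> W \<Longrightarrow> smooth_fun_on M W' f"
  unfolding smooth_fun_on_def smooth_on_def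
  by (clarify, rule Ck_on_subset[where V = "_ ` (_ \<inter> W)"]) auto

lemma smooth_fun_on_Union:
  assumes "\<And>W. W \<in> \<W> \<Longrightarrow> openin (mtop M) W" "\<And>W. W \<in> \<W> \<Longrightarrow> smooth_fun_on M W f"
  shows "smooth_fun_on M (\<Union>\<W>) f"
  unfolding smooth_fun_on_def smooth_on_def
proof (clarify)
  fix U \<phi> k assume c: "(U, \<phi>) \<in> atlas M"
  have "\<phi> ` (U \<inter> \<Union>\<W>) = \<Union>((\<lambda>W. \<phi> ` (U \<inter> W)) ` \<W>)" by blast
  moreover have "Ck_on (mdim M) k (\<Union>((\<lambda>W. \<phi> ` (U \<inter> W)) ` \<W>)) (\<lambda>x. f (inv_into U \<phi> x))"
  proof (rule Ck_on_Union)
    fix V assume "V \<in> (\<lambda>W. \<phi> ` (U \<inter> W)) ` \<W>"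
    then obtain W where W: "W \<in> \<W>" "V = \<phi> ` (U \<inter> W)" by blast
    show "openin (Euclidean_space (mdim M)) V"
      using W openin_chart_image[OF c assms(1)] by blast
    show "Ck_on (mdim M) k V (\<lambda>x. f (inv_into U \<phi> x))"
      using assms(2)[OF W(1)] c W(2) unfolding smooth_fun_on_def smooth_on_def by fast
  qed
  ultimately show "Ck_on (mdim M) k (\<phi> ` (U \<inter> \<Union>\<W>)) (\<lambda>x. f (inv_into U \<phi> x))" by simp
qed

lemma smooth_fun_on_local:
  assumes "\<And>q. q \<in> W \<Longrightarrow> \<exists>W'. openin (mtop M) W' \<and> q \<in> W' \<and> W' \<subseteq> W \<and> smooth_fun_on M W' f"
  shows "smooth_fun_on M W f"
proof -
  have "W = \<Union>{W'. openin (mtop M) W' \<and> W' \<subseteq> W \<and> smooth_fun_on M W' f}"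
    using assms by blast
  then show ?thesis
    by (metis (no_types, lifting) mem_Collect_eq smooth_fun_on_Union)
qed

lemma smooth_fun_on_const: "smooth_fun_on M W (\<lambda>_. c)"
  by (auto simp: smooth_fun_on_def smooth_on_def Ck_on_const)

lemma smooth_fun_on_add:
  assumes "openin (mtop M) W" "smooth_fun_on M W f" "smooth_fun_on M W g"
  shows "smooth_fun_on M W (\<lambda>q. f q + g q)"
  using assms(2,3) unfolding smooth_fun_on_def smooth_on_def
  by (clarify, intro Ck_on_add openin_chart_image assms(1)) auto

lemma smooth_fun_on_mult:
  assumes "openin (mtop M) W" "smooth_fun_on M W f" "smooth_fun_on M W g"
  shows "smooth_fun_on M W (\<lambda>q. f q * g q)"
  using assms(2,3) unfolding smooth_fun_on_def smooth_on_def
  by (clarify, intro Ck_on_mult openin_chart_image assms(1)) auto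

lemma smooth_fun_on_flat:
  assumes "openin (mtop M) W" "smooth_fun_on M W f"
  shows "smooth_fun_on M W (\<lambda>q. flat m (f q))"
  using assms(2) unfolding smooth_fun_on_def smooth_on_def
  by (clarify, intro Ck_on_flat openin_chart_image assms(1)) auto

lemma smooth_fun_on_sum:
  assumes "openin (mtop M) W" "\<And>i. i \<in> I \<Longrightarrow> smooth_fun_on M W (f i)"
  shows "smooth_fun_on M W (\<lambda>q. \<Sum>i\<in>I. f i q)"
  using assms(2)
  by (induction I rule: infinite_finite_induct)
    (auto intro: smooth_fun_on_const smooth_fun_on_add[OF assms(1)])

text \<open>Smoothness is tested in every chart of the atlas, and in another chart a coordinate
  function is a component of a transition map.\<close>

lemma smooth_fun_on_coordinate:
  assumes "(U, \<phi>) \<in> atlas M" "i < mdim M"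
  shows "smooth_fun_on M U (\<lambda>q. \<phi> q i)"
  unfolding smooth_fun_on_def
proof clarify
  fix V \<psi> assume "(V, \<psi>) \<in> atlas M"
  then have "smooth_transition (mdim M) (V, \<psi>) (U, \<phi>)"
    using M assms(1) unfolding smooth_manifold_def by blast
  then show "smooth_on (mdim M) (\<psi> ` (V \<inter> U)) (\<lambda>x. \<phi> (inv_into V \<psi> x) i)"
    using assms(2) unfolding smooth_transition_def by blast
qed

text \<open>A nonzero value at \<open>p\<close> is enough, since users can divide by it. The closed
  set \<open>K\<close> matters more: on its open complement \<open>b\<close> is constantly 0, so
  anything multiplied by \<open>b\<close> extends by 0 beyond \<open>W\<close>.\<close>

lemma bump_function:
  assumes W: "openin (mtop M) W" "p \<in> W"
  obtains b :: "'m \<Rightarrow> real" and K where "closedin (mtop M) K" "K \<subseteq> W"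
    "smooth_fun_on M (points M) b" "b p \<noteq> 0" "\<And>q. q \<notin> K \<Longrightarrow> b q = 0"
proof -
  have "p \<in> points M" using W openin_subset by blast
  then obtain U \<phi> where c: "(U, \<phi>) \<in> atlas M" and p: "p \<in> U"
    using M unfolding smooth_manifold_def by blast
  define n where "n = mdim M"
  note cp = chart_props[OF c, folded n_def]
  obtain \<delta> where \<delta>: "\<delta> > 0"
    and box: "{y. (\<forall>i<n. \<bar>y i - \<phi> p i\<bar> \<le> \<delta>) \<and> (\<forall>i\<ge>n. y i = 0)} \<subseteq> \<phi> ` (U \<inter> W)"
    using ball_box_subset_open[OF openin_chart_image[OF c W(1)], of "\<phi> p"] W(2) p
    unfolding n_def by blast
  define B where "B = {y. (\<forall>i<n. \<bar>y i - \<phi> p i\<bar> \<le> \<delta>) \<and> (\<forall>i\<ge>n. y i = 0)}"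
  define K where "K = {q \<in> U. \<phi> q \<in> B}"
  obtain g where g: "homeomorphic_maps (subtopology (mtop M) U) (subtopology (Euclidean_space n) (\<phi> ` U)) \<phi> g"
    using cp(4) homeomorphic_map_maps by blast
  have U: "topspace (subtopology (mtop M) U) = U"
    using openin_subset[OF cp(1)] by auto
  have gq: "g (\<phi> q) = q" if "q \<in> U" for q
    using g that U unfolding homeomorphic_maps_map by blast
  have "g ` B = K"
  proof (intro subset_antisym subsetI)
    fix q assume "q \<in> g ` B"
    then obtain q' where "\<phi> q' \<in> B" "q' \<in> U" "q = g (\<phi> q')"
      using box unfolding B_def[symmetric] by blast
    then show "q \<in> K" using gq by (simp add: K_def)
  next
    fix q assume "q \<in> K"
    then have "q = g (\<phi> q)" "\<phi> q \<in> B" using gq by (auto simp: K_def)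
    then show "q \<in> g ` B" by blast
  qed
  moreover have "compactin (subtopology (Euclidean_space n) (\<phi> ` U)) B"
    using compactin_box[of n "\<phi> p" \<delta>] box unfolding B_def compactin_subtopology by blast
  ultimately have "compactin (subtopology (mtop M) U) K"
    using g image_compactin unfolding homeomorphic_maps_def by metis
  then have "compactin (mtop M) K" by (simp add: compactin_subtopology)
  moreover have "Hausdorff_space (mtop M)" using M by (simp add: smooth_manifold_def)
  \<comment> \<open>\<open>K\<close> is compact in the chart domain, hence in the manifold, and the
    Hausdorff property makes it closed there. Closedness within \<open>U\<close> alone would not
    permit extension by 0.\<close>
  ultimately have K: "closedin (mtop M) K" by (rule compactin_imp_closedin[rotated])
  \<comment> \<open>This is the flat function of \<delta>^2 minus the squared coordinate distance to
    \<open>p\<close>, spelled with sums and products only so that the closure lemmas apply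
    literally. It is nonzero on a coordinate ball, which lies inside the box defining
    \<open>K\<close>.\<close>
  define b where "b q = (if q \<in> U then flat 0 (\<delta>\<^sup>2 + (\<Sum>i<n. (- 1) * ((\<phi> q i + - \<phi> p i) * (\<phi> q i + - \<phi> p i)))) else 0)" for q
  have b0: "b q = 0" if "q \<notin> K" for q
  proof (rule ccontr)
    assume b: "b q \<noteq> 0"
    then have q: "q \<in> U" by (auto simp: b_def split: if_splits)
    then have sum: "(\<Sum>i<n. (\<phi> q i - \<phi> p i)\<^sup>2) < \<delta>\<^sup>2"
      using b by (auto simp: b_def flat_def power2_eq_square sum_negf split: if_splits)
    have "\<bar>\<phi> q i - \<phi> p i\<bar> \<le> \<delta>" if "i < n" for i
    proof -
      have "(\<phi> q i - \<phi> p i)\<^sup>2 \<le> (\<Sum>i<n. (\<phi> q i - \<phi> p i)\<^sup>2)"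
        using that by (intro member_le_sum) auto
      then have "(\<phi> q i - \<phi> p i)\<^sup>2 \<le> \<delta>\<^sup>2" using sum by linarith
      then show ?thesis using \<delta> by (simp add: abs_le_square_iff[symmetric])
    qed
    moreover have "\<phi> q i = 0" if "i \<ge> n" for i
      using openin_subset[OF cp(2)] q that unfolding topspace_Euclidean_space by blast
    ultimately show False using that q by (auto simp: K_def B_def)
  qed
  have "smooth_fun_on M U (\<lambda>q. flat 0 (\<delta>\<^sup>2 + (\<Sum>i<n. (- 1) * ((\<phi> q i + - \<phi> p i) * (\<phi> q i + - \<phi> p i)))))"
    by (intro smooth_fun_on_flat smooth_fun_on_add smooth_fun_on_sum smooth_fun_on_mult
        smooth_fun_on_const smooth_fun_on_coordinate[OF c] cp(1)) (auto simp: n_def)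
  then have 1: "smooth_fun_on M U b"
    by (rule smooth_fun_on_cong[OF cp(1)]) (simp add: b_def)
  have "openin (mtop M) (points M - K)" using K by blast
  then have 2: "smooth_fun_on M (points M - K) b"
    by (rule smooth_fun_on_cong[OF _ smooth_fun_on_const[of _ 0]]) (simp add: b0)
  \<comment> \<open>On \<open>U\<close> the function is given by the formula, off \<open>K\<close>
    it is 0; these two open sets cover the manifold.\<close>
  have "points M = \<Union>{U, points M - K}"
    using openin_subset[OF cp(1)] by (auto simp: K_def)
  then have "smooth_fun_on M (points M) b"
    using smooth_fun_on_Union[of "{U, points M - K}" b] 1 2 cp(1) K by fastforce
  moreover have "b p \<noteq> 0" using p \<delta> flat_pos[of "\<delta>\<^sup>2" 0] by (simp add: b_def)
  moreover have "K \<subseteq> W"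
  proof
    fix q assume "q \<in> K"
    then have "q \<in> U" "\<phi> q \<in> \<phi> ` (U \<inter> W)" using box by (auto simp: K_def B_def)
    then show "q \<in> W" using cp(3) by (auto dest: inj_onD)
  qed
  ultimately show thesis using that[OF K] b0 by blast
qed

end

section \<open>Local sections of vector bundles\<close>

lemma linear_on_zero: "subspace S \<Longrightarrow> linear_on S f \<Longrightarrow> f 0 = 0"
  unfolding linear_on_def by (metis scale_zero_left subspace_0)

lemma linear_on_sum:
  assumes "subspace S" "linear_on S f" "\<And>i. i \<in> I \<Longrightarrow> v i \<in> S"
  shows "f (\<Sum>i\<in>I. c i *\<^sub>R v i) = (\<Sum>i\<in>I. c i *\<^sub>R f (v i))"
  using assms(3)
proof (induction I rule: infinite_finite_induct)
  case (insert i I)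
  have "(\<Sum>i\<in>I. c i *\<^sub>R v i) \<in> S"
    using insert.prems by (intro subspace_sum subspace_scale assms(1)) auto
  moreover have "c i *\<^sub>R v i \<in> S" "v i \<in> S"
    using insert.prems by (auto intro: subspace_scale assms(1))
  ultimately show ?case
    using insert assms(2) by (simp add: linear_on_def)
qed (simp_all add: linear_on_zero[OF assms(1,2)])

lemma sum_fun_apply: "(\<Sum>i\<in>I. f i) x = (\<Sum>i\<in>I. f i x)"
  for f :: "'i \<Rightarrow> 'a \<Rightarrow> 'b::comm_monoid_add"
  by (induction I rule: infinite_finite_induct) auto

text \<open>Unlike \<open>sections\<close>, this puts no condition on values outside
  \<open>W\<close>, so frames, meaningful only over a trivialising set, qualify. Smoothness of
  bundle maps is also phrased through it.\<close>

definition local_section ::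
  "'m manifold \<Rightarrow> ('m, 'v::real_vector, 'z) vbundle_scheme \<Rightarrow> 'm set \<Rightarrow> ('m \<Rightarrow> 'v) \<Rightarrow> bool"
  where "local_section M E W s \<longleftrightarrow>
    (\<forall>q\<in>W. s q \<in> fibre E q) \<and>
    (\<forall>(V, \<Psi>)\<in>trivs E. \<forall>j<rank E. smooth_fun_on M (W \<inter> V) (\<lambda>q. \<Psi> q (s q) j))"

lemma local_sectionI:
  assumes "\<And>q. q \<in> W \<Longrightarrow> s q \<in> fibre E q"
    "\<And>V \<Psi> j. (V, \<Psi>) \<in> trivs E \<Longrightarrow> j < rank E \<Longrightarrow> smooth_fun_on M (W \<inter> V) (\<lambda>q. \<Psi> q (s q) j)"
  shows "local_section M E W s"
  using assms unfolding local_section_def by blast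

lemma local_sectionD:
  assumes "local_section M E W s"
  shows "q \<in> W \<Longrightarrow> s q \<in> fibre E q"
    "(V, \<Psi>) \<in> trivs E \<Longrightarrow> j < rank E \<Longrightarrow> smooth_fun_on M (W \<inter> V) (\<lambda>q. \<Psi> q (s q) j)"
  using assms unfolding local_section_def by auto

context
  fixes M :: "'m manifold" and E :: "('m, 'v::real_vector, 'z) vbundle_scheme"
  assumes M: "smooth_manifold M" and E: "vector_bundle M E"
begin

lemma subspace_fibre: "p \<in> points M \<Longrightarrow> subspace (fibre E p)"
  using E by (simp add: vector_bundle_def)

lemma triv_props:
  assumes "(U, \<Phi>) \<in> trivs E"
  shows "openin (mtop M) U" "U \<subseteq> points M" "p \<in> U \<Longrightarrow> linear_on (fibre E p) (\<Phi> p)"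
    "p \<in> U \<Longrightarrow> bij_betw (\<Phi> p) (fibre E p) (topspace (Euclidean_space (rank E)))"
proof -
  have *: "openin (mtop M) U \<and> (\<forall>p\<in>U. linear_on (fibre E p) (\<Phi> p) \<and>
              bij_betw (\<Phi> p) (fibre E p) (topspace (Euclidean_space (rank E))))"
    using E assms unfolding vector_bundle_def by fast
  then show "openin (mtop M) U" "p \<in> U \<Longrightarrow> linear_on (fibre E p) (\<Phi> p)"
    "p \<in> U \<Longrightarrow> bij_betw (\<Phi> p) (fibre E p) (topspace (Euclidean_space (rank E)))"
    by auto
  then show "U \<subseteq> points M" by (simp add: openin_subset)
qed

lemma triv_exists:
  assumes "p \<in> points M" obtains U \<Phi> where "(U, \<Phi>) \<in> trivs E" "p \<in> U"
proof -
  have "(\<Union>(U, \<Phi>)\<in>trivs E. U) = points M" using E by (simp add: vector_bundle_def)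
  then show thesis using assms that by blast
qed

lemma frame_props:
  assumes "(U, \<Phi>) \<in> trivs E" "p \<in> U" "i < rank E"
  shows "frame E \<Phi> i p \<in> fibre E p" "\<Phi> p (frame E \<Phi> i p) = unit_tuple i"
proof -
  have "unit_tuple i \<in> \<Phi> p ` fibre E p"
    using triv_props(4)[OF assms(1,2)] assms(3)
    by (auto simp: bij_betw_def unit_tuple_def topspace_Euclidean_space)
  then show "frame E \<Phi> i p \<in> fibre E p" "\<Phi> p (frame E \<Phi> i p) = unit_tuple i"
    unfolding frame_def by (auto intro: inv_into_into f_inv_into_f)
qed

text \<open>Both sides have the same image under the injective \<open>\<Phi> p\<close>. Tuples are
  infinite sequences, so agreement from index \<open>rank E\<close> on is also required; there both
  vanish.\<close>

lemma frame_expansion: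
  assumes "(U, \<Phi>) \<in> trivs E" "p \<in> U" "v \<in> fibre E p"
  shows "v = (\<Sum>i<rank E. \<Phi> p v i *\<^sub>R frame E \<Phi> i p)"
proof -
  note t = triv_props[OF assms(1)]
  have sub: "subspace (fibre E p)" using assms(2) t subspace_fibre by blast
  have "\<Phi> p v \<in> topspace (Euclidean_space (rank E))"
    using t(4)[OF assms(2)] assms(3) by (auto simp: bij_betw_def)
  then have 0: "\<Phi> p v j = 0" if "j \<ge> rank E" for j
    using that by (auto simp: topspace_Euclidean_space)
  have "\<Phi> p (\<Sum>i<rank E. \<Phi> p v i *\<^sub>R frame E \<Phi> i p) = (\<Sum>i<rank E. \<Phi> p v i *\<^sub>R \<Phi> p (frame E \<Phi> i p))"
    using frame_props[OF assms(1,2)] by (intro linear_on_sum[OF sub t(3)[OF assms(2)]]) auto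
  also have "\<dots> = \<Phi> p v"
  proof
    fix j
    have "(\<Sum>i<rank E. \<Phi> p v i *\<^sub>R \<Phi> p (frame E \<Phi> i p)) j =
        (\<Sum>i<rank E. if j = i then \<Phi> p v i else 0)"
      unfolding sum_fun_apply scaleR_fun_def
      by (intro sum.cong) (auto simp: frame_props[OF assms(1,2)] unit_tuple_def)
    then show "(\<Sum>i<rank E. \<Phi> p v i *\<^sub>R \<Phi> p (frame E \<Phi> i p)) j = \<Phi> p v j"
      using 0 by auto
  qed
  finally have eq: "\<Phi> p v = \<Phi> p (\<Sum>i<rank E. \<Phi> p v i *\<^sub>R frame E \<Phi> i p)" ..
  have "(\<Sum>i<rank E. \<Phi> p v i *\<^sub>R frame E \<Phi> i p) \<in> fibre E p"
    using frame_props[OF assms(1,2)] by (intro subspace_sum subspace_scale sub) auto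
  with bij_betw_imp_inj_on[OF t(4)[OF assms(2)]] eq assms(3) show ?thesis
    by (rule inj_onD)
qed

lemma local_section_frame:
  assumes "(U, \<Phi>) \<in> trivs E" "i < rank E"
  shows "local_section M E U (frame E \<Phi> i)"
proof (rule local_sectionI)
  fix V \<Psi> j assume "(V, \<Psi>) \<in> trivs E" "j < rank E"
  then show "smooth_fun_on M (U \<inter> V) (\<lambda>q. \<Psi> q (frame E \<Phi> i q) j)"
    using E assms unfolding vector_bundle_def by fast
qed (use frame_props assms in auto)

lemma local_section_subset:
  assumes "local_section M E W s" "W' \<subseteq> W"
  shows "local_section M E W' s"
proof (rule local_sectionI)
  show "s q \<in> fibre E q" if "q \<in> W'" for q
    using local_sectionD(1)[OF assms(1)] assms(2) that by blast
  fix V \<Psi> j assume "(V, \<Psi>) \<in> trivs E" "j < rank E"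
  then have "smooth_fun_on M (W \<inter> V) (\<lambda>q. \<Psi> q (s q) j)"
    by (rule local_sectionD(2)[OF assms(1)])
  then show "smooth_fun_on M (W' \<inter> V) (\<lambda>q. \<Psi> q (s q) j)"
    by (rule smooth_fun_on_subset[OF M]) (use assms(2) in blast)
qed

lemma local_section_cong:
  assumes "openin (mtop M) W" "local_section M E W s" "\<And>q. q \<in> W \<Longrightarrow> s q = s' q"
  shows "local_section M E W s'"
proof (rule local_sectionI)
  fix V \<Psi> j assume V: "(V, \<Psi>) \<in> trivs E" "j < rank E"
  show "smooth_fun_on M (W \<inter> V) (\<lambda>q. \<Psi> q (s' q) j)"
    by (rule smooth_fun_on_cong[OF M _ local_sectionD(2)[OF assms(2) V]])
      (use assms triv_props(1)[OF V(1)] in auto)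
qed (use local_sectionD(1)[OF assms(2)] assms(3) in auto)

lemma local_section_local:
  assumes "\<And>q. q \<in> W \<Longrightarrow> \<exists>W'. openin (mtop M) W' \<and> q \<in> W' \<and> W' \<subseteq> W \<and> local_section M E W' s"
  shows "local_section M E W s"
proof (rule local_sectionI)
  fix q assume "q \<in> W"
  then obtain W' where "q \<in> W'" "local_section M E W' s" using assms by blast
  then show "s q \<in> fibre E q" using local_sectionD(1) by metis
next
  fix V \<Psi> j assume V: "(V, \<Psi>) \<in> trivs E" "j < rank E"
  show "smooth_fun_on M (W \<inter> V) (\<lambda>q. \<Psi> q (s q) j)"
  proof (rule smooth_fun_on_local[OF M])
    fix q assume q: "q \<in> W \<inter> V"
    then obtain W' where W': "openin (mtop M) W'" "q \<in> W'" "W' \<subseteq> W" "local_section M E W' s"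
      using assms by blast
    then show "\<exists>W'. openin (mtop M) W' \<and> q \<in> W' \<and> W' \<subseteq> W \<inter> V \<and>
        smooth_fun_on M W' (\<lambda>q. \<Psi> q (s q) j)"
      using local_sectionD(2)[OF W'(4) V] triv_props(1)[OF V(1)] q
      by (intro exI[of _ "W' \<inter> V"]) auto
  qed
qed

text \<open>Local sections form a module over the smooth functions. Choosing \<open>I\<close> as the
  empty set, a one-point set, the booleans or the frame indices yields the zero section, multiples,
  sums and frame combinations.\<close>

lemma local_section_combination:
  assumes W: "openin (mtop M) W"
    and f: "\<And>i. i \<in> I \<Longrightarrow> smooth_fun_on M W (f i)"
    and s: "\<And>i. i \<in> I \<Longrightarrow> local_section M E W (s i)"
  shows "local_section M E W (\<lambda>q. \<Sum>i\<in>I. f i q *\<^sub>R s i q)"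
proof (rule local_sectionI)
  have sub: "subspace (fibre E q)" if "q \<in> W" for q
    using openin_subset[OF W] that by (intro subspace_fibre) auto
  show "(\<Sum>i\<in>I. f i q *\<^sub>R s i q) \<in> fibre E q" if "q \<in> W" for q
    by (rule subspace_sum[OF sub[OF that]])
      (rule subspace_scale[OF sub[OF that] local_sectionD(1)[OF s that]])
  fix V \<Psi> j assume V: "(V, \<Psi>) \<in> trivs E" "j < rank E"
  have WV: "openin (mtop M) (W \<inter> V)" using W triv_props(1)[OF V(1)] by blast
  have "smooth_fun_on M (W \<inter> V) (\<lambda>q. \<Sum>i\<in>I. f i q * \<Psi> q (s i q) j)"
  proof (rule smooth_fun_on_sum[OF M WV])
    fix i assume i: "i \<in> I"
    have "smooth_fun_on M (W \<inter> V) (f i)"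
      by (rule smooth_fun_on_subset[OF M f[OF i]]) blast
    then show "smooth_fun_on M (W \<inter> V) (\<lambda>q. f i q * \<Psi> q (s i q) j)"
      by (rule smooth_fun_on_mult[OF M WV _ local_sectionD(2)[OF s[OF i] V]])
  qed
  then show "smooth_fun_on M (W \<inter> V) (\<lambda>q. \<Psi> q (\<Sum>i\<in>I. f i q *\<^sub>R s i q) j)"
  proof (rule smooth_fun_on_cong[OF M WV])
    fix q assume q: "q \<in> W \<inter> V"
    have "\<Psi> q (\<Sum>i\<in>I. f i q *\<^sub>R s i q) = (\<Sum>i\<in>I. f i q *\<^sub>R \<Psi> q (s i q))"
    proof (rule linear_on_sum[OF sub triv_props(3)[OF V(1)]])
      show "s i q \<in> fibre E q" if "i \<in> I" for i
        using local_sectionD(1)[OF s[OF that]] q by blast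
    qed (use q in auto)
    then show "(\<Sum>i\<in>I. f i q * \<Psi> q (s i q) j) = \<Psi> q (\<Sum>i\<in>I. f i q *\<^sub>R s i q) j"
      by (simp add: sum_fun_apply scaleR_fun_def)
  qed
qed

section \<open>Bundle endomorphisms and their action on local sections\<close>

lemma bundle_mapD:
  assumes "bundle_map M E E h"
  shows "p \<in> points M \<Longrightarrow> linear_on (fibre E p) (h p)"
    "p \<in> points M \<Longrightarrow> v \<in> fibre E p \<Longrightarrow> h p v \<in> fibre E p"
    "(U, \<Phi>) \<in> trivs E \<Longrightarrow> i < rank E \<Longrightarrow> local_section M E U (\<lambda>q. h q (frame E \<Phi> i q))"
proof -
  show *: "linear_on (fibre E p) (h p)" if "p \<in> points M" for p
    using assms that by (simp add: bundle_map_def)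
  show **: "h p v \<in> fibre E p" if "p \<in> points M" "v \<in> fibre E p" for p v
    using assms that by (auto simp: bundle_map_def)
  show "local_section M E U (\<lambda>q. h q (frame E \<Phi> i q))" if U: "(U, \<Phi>) \<in> trivs E" and i: "i < rank E"
  proof (rule local_sectionI)
    show "h q (frame E \<Phi> i q) \<in> fibre E q" if "q \<in> U" for q
      using that triv_props(2)[OF U] by (auto intro!: ** frame_props[OF U _ i])
    fix V \<Psi> j assume "(V, \<Psi>) \<in> trivs E" "j < rank E"
    then show "smooth_fun_on M (U \<inter> V) (\<lambda>q. \<Psi> q (h q (frame E \<Phi> i q)) j)"
      using assms U i unfolding bundle_map_def by fast
  qed
qed

lemma bundle_mapI:
  assumes "\<And>p. p \<in> points M \<Longrightarrow> linear_on (fibre E p) (h p)"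
    "\<And>p v. p \<in> points M \<Longrightarrow> v \<in> fibre E p \<Longrightarrow> h p v \<in> fibre E p"
    "\<And>U \<Phi> i. (U, \<Phi>) \<in> trivs E \<Longrightarrow> i < rank E \<Longrightarrow> local_section M E U (\<lambda>q. h q (frame E \<Phi> i q))"
  shows "bundle_map M E E h"
proof -
  have "\<forall>(U, \<Phi>)\<in>trivs E. \<forall>(V, \<Psi>)\<in>trivs E. \<forall>i<rank E. \<forall>j<rank E.
      smooth_fun_on M (U \<inter> V) (\<lambda>p. \<Psi> p (h p (frame E \<Phi> i p)) j)"
    by (clarify, rule local_sectionD(2)[OF assms(3)])
  then show ?thesis using assms(1,2) by (auto simp: bundle_map_def)
qed

text \<open>A bundle map is known to be smooth only on frames. Expanding \<open>s\<close> in a frame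
  turns \<open>h q (s q)\<close> into a combination of the images of the frame with smooth
  coefficients; frames exist only locally, hence the localisation.\<close>

lemma local_section_bundle_map:
  assumes h: "bundle_map M E E h" and W: "openin (mtop M) W" and s: "local_section M E W s"
  shows "local_section M E W (\<lambda>q. h q (s q))"
proof (rule local_section_local)
  fix q assume q: "q \<in> W"
  then obtain U \<Phi> where U: "(U, \<Phi>) \<in> trivs E" "q \<in> U"
    using openin_subset[OF W] triv_exists by blast
  note t = triv_props[OF U(1)]
  have WU: "openin (mtop M) (W \<inter> U)" using W t(1) by blast
  have "local_section M E (W \<inter> U) (\<lambda>q. \<Sum>i<rank E. \<Phi> q (s q) i *\<^sub>R h q (frame E \<Phi> i q))"
  proof (rule local_section_combination[OF WU])
    fix i assume "i \<in> {..<rank E}"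
    then have i: "i < rank E" by simp
    show "smooth_fun_on M (W \<inter> U) (\<lambda>q. \<Phi> q (s q) i)"
      by (rule local_sectionD(2)[OF s U(1) i])
    show "local_section M E (W \<inter> U) (\<lambda>q. h q (frame E \<Phi> i q))"
      by (rule local_section_subset[OF bundle_mapD(3)[OF h U(1) i]]) blast
  qed
  then have "local_section M E (W \<inter> U) (\<lambda>q. h q (s q))"
  proof (rule local_section_cong[OF WU])
    fix q assume q: "q \<in> W \<inter> U"
    have "h q (s q) = h q (\<Sum>i<rank E. \<Phi> q (s q) i *\<^sub>R frame E \<Phi> i q)"
      using frame_expansion[OF U(1) _ local_sectionD(1)[OF s]] q by auto
    also have "\<dots> = (\<Sum>i<rank E. \<Phi> q (s q) i *\<^sub>R h q (frame E \<Phi> i q))"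
    proof (rule linear_on_sum[OF subspace_fibre bundle_mapD(1)[OF h]])
      show "frame E \<Phi> i q \<in> fibre E q" if "i \<in> {..<rank E}" for i
        using frame_props(1)[OF U(1)] q that by auto
    qed (use q t(2) in auto)
    finally show "(\<Sum>i<rank E. \<Phi> q (s q) i *\<^sub>R h q (frame E \<Phi> i q)) = h q (s q)" ..
  qed
  then show "\<exists>W'. openin (mtop M) W' \<and> q \<in> W' \<and> W' \<subseteq> W \<and> local_section M E W' (\<lambda>q. h q (s q))"
    using WU q U(2) by (intro exI[of _ "W \<inter> U"]) auto
qed

lemma bundle_map_comp:
  assumes h: "bundle_map M E E h" and k: "bundle_map M E E k"
  shows "bundle_map M E E (\<lambda>p v. h p (k p v))"
proof (rule bundle_mapI)
  show "linear_on (fibre E p) (\<lambda>v. h p (k p v))" if "p \<in> points M" for p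
    using bundle_mapD(1)[OF h that] bundle_mapD(1,2)[OF k that] by (simp add: linear_on_def)
  show "local_section M E U (\<lambda>q. h q (k q (frame E \<Phi> i q)))"
    if "(U, \<Phi>) \<in> trivs E" "i < rank E" for U \<Phi> i
    by (rule local_section_bundle_map[OF h triv_props(1)[OF that(1)] bundle_mapD(3)[OF k that]])
qed (use bundle_mapD(2)[OF h] bundle_mapD(2)[OF k] in auto)

lemma bundle_map_scale:
  assumes h: "bundle_map M E E h"
  shows "bundle_map M E E (\<lambda>p v. c *\<^sub>R h p v)"
proof (rule bundle_mapI)
  show "linear_on (fibre E p) (\<lambda>v. c *\<^sub>R h p v)" if "p \<in> points M" for p
    using bundle_mapD(1)[OF h that] by (simp add: linear_on_def scaleR_add_right)
  show "local_section M E U (\<lambda>q. c *\<^sub>R h q (frame E \<Phi> i q))"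
    if U: "(U, \<Phi>) \<in> trivs E" and i: "i < rank E" for U \<Phi> i
    using local_section_combination[OF triv_props(1)[OF U], of "{()}" "\<lambda>_ _. c"]
      smooth_fun_on_const[OF M] bundle_mapD(3)[OF h U i] by simp
qed (intro subspace_scale subspace_fibre bundle_mapD(2)[OF h])

section \<open>Global sections\<close>

lemma sections_iff:
  "X \<in> sections M E \<longleftrightarrow> local_section M E (points M) X \<and> (\<forall>p. p \<notin> points M \<longrightarrow> X p = 0)"
proof -
  have "points M \<inter> U = U" if "(U, \<Phi>) \<in> trivs E" for U and \<Phi> :: "'m \<Rightarrow> 'v \<Rightarrow> nat \<Rightarrow> real"
    using triv_props(2)[OF that] by blast
  then show ?thesis
    unfolding sections_def local_section_def by fastforce
qed

lemma sections_add_scale: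
  assumes "X \<in> sections M E" "Y \<in> sections M E"
  shows "X + Y \<in> sections M E" "c *\<^sub>R X \<in> sections M E"
proof -
  note c = smooth_fun_on_const[OF M]
  have XY: "local_section M E (points M) X" "local_section M E (points M) Y"
    using assms by (simp_all add: sections_iff)
  \<comment> \<open>A sum of two sections, written as a combination indexed by
    \<open>bool\<close>.\<close>
  have "local_section M E (points M) (\<lambda>q. \<Sum>b\<in>UNIV. 1 *\<^sub>R (if b then X else Y) q)"
    by (rule local_section_combination) (auto simp: c XY)
  then show "X + Y \<in> sections M E"
    using assms by (simp add: sections_iff UNIV_bool plus_fun_def add.commute)
  have "local_section M E (points M) (\<lambda>q. \<Sum>b\<in>{()}. c *\<^sub>R X q)"
    by (rule local_section_combination) (auto simp: c XY)
  then show "c *\<^sub>R X \<in> sections M E"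
    using assms by (simp add: sections_iff scaleR_fun_def)
qed

lemma on_sections_in_sections:
  assumes "bundle_map M E E h" "X \<in> sections M E"
  shows "on_sections M h X \<in> sections M E"
proof -
  have "local_section M E (points M) (\<lambda>q. h q (X q))"
    using assms(2) by (intro local_section_bundle_map[OF assms(1)]) (auto simp: sections_iff)
  then have "local_section M E (points M) (on_sections M h X)"
    by (rule local_section_cong[rotated]) (auto simp: on_sections_def)
  then show ?thesis by (simp add: sections_iff on_sections_def)
qed

text \<open>Over a trivialising set, \<open>w\<close> extends with constant coefficients in the
  frame; the bump function cuts this extension off.\<close>

lemma section_through:
  assumes p: "p \<in> points M" and w: "w \<in> fibre E p"
  obtains X where "X \<in> sections M E" "X p = w"
proof -
  obtain U \<Phi> where U: "(U, \<Phi>) \<in> trivs E" "p \<in> U" using triv_exists[OF p] .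
  note t = triv_props[OF U(1)]
  obtain b K where b: "closedin (mtop M) K" "K \<subseteq> U"
    "smooth_fun_on M (points M) b" "b p \<noteq> 0" "\<And>q. q \<notin> K \<Longrightarrow> b q = 0"
    using bump_function[OF M t(1) U(2)] by metis
  \<comment> \<open>Division by \<open>b p\<close> normalises the bump function, so that the
    coefficients at \<open>p\<close> are exactly those of \<open>w\<close>.\<close>
  define X where "X q = (if q \<in> U then \<Sum>i<rank E. (b q * (\<Phi> p w i / b p)) *\<^sub>R frame E \<Phi> i q else 0)" for q
  have "local_section M E U (\<lambda>q. \<Sum>i<rank E. (b q * (\<Phi> p w i / b p)) *\<^sub>R frame E \<Phi> i q)"
    by (rule local_section_combination[OF t(1) smooth_fun_on_mult[OF M t(1)
            smooth_fun_on_subset[OF M b(3) t(2)] smooth_fun_on_const[OF M]]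
          local_section_frame[OF U(1)]]) auto
  then have 1: "local_section M E U X"
    by (rule local_section_cong[OF t(1)]) (simp add: X_def)
  have X0: "X q = 0" if "q \<notin> K" for q
    using b(5)[OF that] by (simp add: X_def)
  have K: "openin (mtop M) (points M - K)" using b(1) by blast
  \<comment> \<open>The empty combination is the zero section.\<close>
  have "local_section M E (points M - K) (\<lambda>q. \<Sum>i\<in>{}. (0::real) *\<^sub>R (0::'v))"
    by (rule local_section_combination[OF K]) auto
  then have 2: "local_section M E (points M - K) X"
    by (rule local_section_cong[OF K]) (simp add: X0)
  have "local_section M E (points M) X"
  proof (rule local_section_local)
    fix q assume "q \<in> points M"
    then consider "q \<in> U" | "q \<in> points M - K" using b(2) by blast
    then show "\<exists>W'. openin (mtop M) W' \<and> q \<in> W' \<and> W' \<subseteq> points M \<and> local_section M E W' X"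
      by cases (use 1 2 t K in blast)+
  qed
  then have "X \<in> sections M E"
    using t(2) by (auto simp: sections_iff X_def)
  moreover have "X p = w"
    using frame_expansion[OF U w] U(2) b(4) by (simp add: X_def)
  ultimately show thesis by (rule that)
qed

end

section \<open>Squares of skew Nijenhuis operators\<close>

text \<open>
  \<open>S\<close> plays the role of the module of sections, \<open>m\<close> of the product, \<open>n\<close> of the tensor, and the forms
  \<open>B p\<close> of the pairing at the points \<open>p\<close>; the anchor has been eliminated from the identities.
\<close>

locale skew_nijenhuis =
  fixes S :: "'a::real_vector set" and m :: "'a \<Rightarrow> 'a \<Rightarrow> 'a" and n :: "'a \<Rightarrow> 'a"
    and B :: "'i \<Rightarrow> 'a \<Rightarrow> 'a \<Rightarrow> real"
  assumes add_in: "X \<in> S \<Longrightarrow> Y \<in> S \<Longrightarrow> X + Y \<in> S"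
    and diff_in: "X \<in> S \<Longrightarrow> Y \<in> S \<Longrightarrow> X - Y \<in> S"
    and m_in: "X \<in> S \<Longrightarrow> Y \<in> S \<Longrightarrow> m X Y \<in> S"
    and n_in: "X \<in> S \<Longrightarrow> n X \<in> S"
    and m_add_left: "X \<in> S \<Longrightarrow> Y \<in> S \<Longrightarrow> Z \<in> S \<Longrightarrow> m (X + Y) Z = m X Z + m Y Z"
    and m_add_right: "X \<in> S \<Longrightarrow> Y \<in> S \<Longrightarrow> Z \<in> S \<Longrightarrow> m X (Y + Z) = m X Y + m X Z"
    and n_add: "X \<in> S \<Longrightarrow> Y \<in> S \<Longrightarrow> n (X + Y) = n X + n Y"
    and n_diff: "X \<in> S \<Longrightarrow> Y \<in> S \<Longrightarrow> n (X - Y) = n X - n Y"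
    and B_add: "X \<in> S \<Longrightarrow> Y \<in> S \<Longrightarrow> Z \<in> S \<Longrightarrow> B p X (Y + Z) = B p X Y + B p X Z"
    and B_diff: "X \<in> S \<Longrightarrow> Y \<in> S \<Longrightarrow> Z \<in> S \<Longrightarrow> B p X (Y - Z) = B p X Y - B p X Z"
    and B_sym: "X \<in> S \<Longrightarrow> Y \<in> S \<Longrightarrow> B p X Y = B p Y X"
    and nondegenerate: "X \<in> S \<Longrightarrow> (\<And>p Y. Y \<in> S \<Longrightarrow> B p X Y = 0) \<Longrightarrow> X = 0"
    and skew: "X \<in> S \<Longrightarrow> Y \<in> S \<Longrightarrow> B p (n X) Y = - B p X (n Y)"
    and invariance: "X \<in> S \<Longrightarrow> Y \<in> S \<Longrightarrow> B p X (m Y Y) = B p (m X Y) Y"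
    and compat_right: "X \<in> S \<Longrightarrow> Y \<in> S \<Longrightarrow>
      B p (n X) (m Y Y) = B p X (m (n Y) Y + m Y (n Y) - n (m Y Y))"
    and compat_left: "X \<in> S \<Longrightarrow> Y \<in> S \<Longrightarrow>
      B p (n X) (m Y Y) = B p (m (n X) Y + m X (n Y) - n (m X Y)) Y"
    and torsion_free: "X \<in> S \<Longrightarrow> Y \<in> S \<Longrightarrow>
      m (n X) (n Y) = n (m (n X) Y + m X (n Y) - n (m X Y))"
begin

lemmas closed = add_in diff_in m_in n_in

lemma B_left:
  assumes "X \<in> S" "Y \<in> S" "Z \<in> S"
  shows "B p (X + Y) Z = B p X Z + B p Y Z" "B p (X - Y) Z = B p X Z - B p Y Z"
  using assms B_sym[of "X + Y" Z p] B_sym[of "X - Y" Z p] B_sym[of X Z p] B_sym[of Y Z p]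
  by (simp_all add: closed B_add B_diff)

text \<open>Skewness moves \<open>n\<close> off \<open>X\<close> in \<open>compat_right\<close>, and
  the two terms containing \<open>n (m Y Y)\<close> cancel. What remains pairs to 0 with every
  \<open>X\<close>.\<close>

lemma m_n_anticommute:
  assumes Y: "Y \<in> S"
  shows "m (n Y) Y + m Y (n Y) = 0"
proof (rule nondegenerate)
  fix p X assume X: "X \<in> S"
  have "B p (n X) (m Y Y) = B p X (m (n Y) Y + m Y (n Y)) - B p X (n (m Y Y))"
    using compat_right[OF X Y] X Y by (simp add: B_diff closed)
  then have "B p X (m (n Y) Y + m Y (n Y)) = 0"
    using skew[OF X m_in[OF Y Y]] by simp
  then show "B p (m (n Y) Y + m Y (n Y)) X = 0"
    using X Y B_sym closed by simp
qed (use Y closed in simp)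

text \<open>\<open>D X\<close> is the commutator of \<open>m X\<close> and \<open>n\<close>.\<close>

definition D :: "'a \<Rightarrow> 'a \<Rightarrow> 'a"
  where "D X Y = m X (n Y) - n (m X Y)"

lemma D_in: "X \<in> S \<Longrightarrow> Y \<in> S \<Longrightarrow> D X Y \<in> S"
  by (simp add: D_def closed)

lemma D_add: "X \<in> S \<Longrightarrow> Y \<in> S \<Longrightarrow> Z \<in> S \<Longrightarrow> D X (Y + Z) = D X Y + D X Z"
  by (simp add: D_def m_add_right n_add closed)

text \<open>The contracted product is \<open>m (n X) Y + D X Y\<close>. Invariance applied to
  \<open>n X\<close> accounts for the first summand, so the second pairs to 0 with
  \<open>Y\<close>.\<close>

lemma B_D_self:
  assumes "X \<in> S" "Y \<in> S"
  shows "B p (D X Y) Y = 0"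
proof -
  have "B p (n X) (m Y Y) = B p (m (n X) Y + D X Y) Y"
    using compat_left[OF assms] by (simp add: D_def algebra_simps)
  then show ?thesis
    using invariance[OF n_in[OF assms(1)] assms(2)] assms by (simp add: B_left closed D_in)
qed

text \<open>Polarisation of \<open>B_D_self\<close> at \<open>Y + Z\<close>.\<close>

lemma B_D_skew:
  assumes "X \<in> S" "Y \<in> S" "Z \<in> S"
  shows "B p (D X Y) Z = - B p (D X Z) Y"
  using B_D_self[OF assms(1) add_in[OF assms(2,3)], of p] B_D_self[OF assms(1,2), of p]
    B_D_self[OF assms(1,3), of p] assms
  by (simp add: D_add B_left B_add closed D_in)

lemma D_n: "X \<in> S \<Longrightarrow> Y \<in> S \<Longrightarrow> D (n X) Y = n (D X Y)"
  by (simp add: D_def torsion_free closed n_add n_diff)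

text \<open>Skewness holds for \<open>D\<close> at every section, in particular at
  \<open>n X\<close>, so \<open>n\<close> after \<open>D X\<close>, being \<open>D (n X)\<close>, is
  skew. The adjoint of a product of two skew operators is the product in reverse order, so
  \<open>n\<close> after \<open>D X\<close> is also minus \<open>D X\<close> after
  \<open>n\<close>.\<close>

lemma D_n_anticommute:
  assumes X: "X \<in> S" and Y: "Y \<in> S"
  shows "n (D X Y) + D X (n Y) = 0"
proof (rule nondegenerate)
  fix p Z assume Z: "Z \<in> S"
  have "B p (n (D X Y)) Z = - B p (n (D X Z)) Y"
    using B_D_skew[OF n_in[OF X] Y Z] by (simp add: D_n X Y Z)
  also have "\<dots> = B p (D X Z) (n Y)"
    using X Y Z by (simp add: skew D_in)
  also have "\<dots> = - B p (D X (n Y)) Z"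
    using X Y Z by (simp add: B_D_skew[of X Z] closed)
  finally show "B p (n (D X Y) + D X (n Y)) Z = 0"
    using X Y Z by (simp add: B_left closed D_in)
qed (use X Y in \<open>simp add: closed D_in\<close>)

text \<open>The sum \<open>n (D X Y) + D X (n Y)\<close> telescopes: the middle term
  \<open>n (m X (n Y))\<close> cancels, leaving the commutator of \<open>m X\<close> with the square
  of \<open>n\<close>.\<close>

lemma m_square_right:
  assumes "X \<in> S" "Y \<in> S"
  shows "m X (n (n Y)) = n (n (m X Y))"
  using D_n_anticommute[OF assms] assms by (simp add: D_def n_diff closed)

text \<open>Write Q for n(n(m Y Y)). Anticommutation at Y + nY, minus the cases Y and nY, leaves
  m(nnY)Y + m Y(nnY) + 2 m(nY)(nY) = 0. The middle term is Q by \<open>m_square_right\<close>;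
  m(nY)(nY) = -Q by vanishing torsion, since the contracted square of Y is -n(m Y Y). Hence m(nnY)Y
  = Q.\<close>

lemma square_m_self:
  assumes Y: "Y \<in> S"
  shows "n (n (m Y Y)) = m (n (n Y)) Y"
proof -
  have "m (n (Y + n Y)) (Y + n Y) + m (Y + n Y) (n (Y + n Y)) = 0"
    using m_n_anticommute Y closed by simp
  then have "m (n (n Y)) Y + m Y (n (n Y)) + (m (n Y) (n Y) + m (n Y) (n Y)) +
      (m (n Y) Y + m Y (n Y)) + (m (n (n Y)) (n Y) + m (n Y) (n (n Y))) = 0"
    using Y by (simp add: n_add m_add_left m_add_right closed algebra_simps)
  then have "m (n (n Y)) Y + m Y (n (n Y)) + (m (n Y) (n Y) + m (n Y) (n Y)) = 0"
    using m_n_anticommute Y closed by simp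
  moreover have "m (n Y) (n Y) = - n (n (m Y Y))"
  proof -
    have "m (n Y) Y + m Y (n Y) - n (m Y Y) = 0 - n (m Y Y)"
      by (simp add: m_n_anticommute Y)
    \<comment> \<open>The locale provides only sums and differences, so \<open>n 0 = 0\<close> is
      obtained by writing 0 as Z - Z.\<close>
    moreover have "n (0 - n (m Y Y)) = - n (n (m Y Y))"
      using n_diff[of "n (m Y Y)" "n (m Y Y)"] n_diff[of "n (m Y Y) - n (m Y Y)" "n (m Y Y)"] Y
      by (simp add: closed) (use closed diff_in in force)
    ultimately show ?thesis using torsion_free[OF Y Y] by simp
  qed
  moreover have "m Y (n (n Y)) = n (n (m Y Y))" using m_square_right[OF Y Y] .
  ultimately show ?thesis by (simp add: eq_iff_diff_eq_0[of "n _"])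
qed

end

section \<open>Orthogonal Courant-Nijenhuis tensors\<close>

lemma pairing_bilinear:
  assumes A: "nondegenerate_pairing M A" and sub: "subspace (fibre A p)" and p: "p \<in> points M"
    and u: "u \<in> fibre A p" and v: "v \<in> fibre A p"
  shows "pairing A p u v = pairing A p v u"
    "w \<in> fibre A p \<Longrightarrow> pairing A p u (v + w) = pairing A p u v + pairing A p u w"
    "pairing A p u (c *\<^sub>R v) = c * pairing A p u v"
    "pairing A p (c *\<^sub>R v) u = c * pairing A p v u"
proof -
  have "\<forall>v\<in>fibre A p. linear_on (fibre A p) (pairing A p v)"
    and s: "\<forall>v\<in>fibre A p. \<forall>w\<in>fibre A p. pairing A p v w = pairing A p w v"
    using A p unfolding nondegenerate_pairing_def by auto
  then have l: "linear_on (fibre A p) (pairing A p u)" using u by simp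
  show "pairing A p u v = pairing A p v u" using s u v by simp
  show "pairing A p u (v + w) = pairing A p u v + pairing A p u w" if "w \<in> fibre A p"
    using l v that by (simp add: linear_on_def)
  show *: "pairing A p u (c *\<^sub>R v) = c * pairing A p u v"
    using l v by (simp add: linear_on_def)
  show "pairing A p (c *\<^sub>R v) u = c * pairing A p v u"
    using * s u v subspace_scale[OF sub v] by simp
qed

lemma orthogonal_tensor_skew:
  assumes A: "courant_algebroid M A" and N: "orthogonal_tensor M A N"
    and p: "p \<in> points M" and v: "v \<in> fibre A p" and w: "w \<in> fibre A p"
  shows "pairing A p (N p v) w = - pairing A p v (N p w)"
proof -
  have M: "smooth_manifold M" and E: "vector_bundle M A" and P: "nondegenerate_pairing M A"
    using A by (simp_all add: courant_algebroid_def)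
  obtain N' where N': "is_adjoint M A N N'" "tensor_eq M A (N + N') (scalar_tensor 0)"
    using N unfolding orthogonal_tensor_def by blast
  have "N p w + N' p w = 0"
    using N'(2) p w by (simp add: tensor_eq_def scalar_tensor_def)
  then have eq: "N p w = (- 1) *\<^sub>R N' p w" by (simp add: eq_neg_iff_add_eq_0)
  have N'w: "N' p w \<in> fibre A p"
    using N'(1) p w by (auto simp: is_adjoint_def tensor11_def bundle_map_def)
  have "pairing A p v (N p w) = - pairing A p v (N' p w)"
    unfolding eq using pairing_bilinear(3)[OF P subspace_fibre[OF M E p] p v N'w, of "-1"]
    by simp
  then show ?thesis using N'(1) p v w by (simp add: is_adjoint_def)
qed

lemma on_sections_tensor_square:
  "on_sections M (tensor_square N) X = on_sections M N (on_sections M N X)"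
  by (simp add: on_sections_def tensor_square_def fun_eq_iff)

text \<open>These are the conditions that irreducibility imposes on a tensor, here for the square of
  \<open>N\<close>.\<close>

lemma orthogonal_courant_nijenhuis_square:
  fixes M :: "'m manifold" and A :: "('m, 'v::real_vector) courant"
  assumes A: "courant_algebroid M A" and N: "orthogonal_courant_nijenhuis M A N"
    and X: "X \<in> sections M A" and Y: "Y \<in> sections M A"
  shows "bracket A X (on_sections M (tensor_square N) Y) =
      on_sections M (tensor_square N) (bracket A X Y)"
    "on_sections M (tensor_square N) (bracket A Y Y) =
      bracket A (on_sections M (tensor_square N) Y) Y"
proof -
  have M: "smooth_manifold M" and E: "vector_bundle M A" and P: "nondegenerate_pairing M A"
    and b: "bilinear_product M A (bracket A)" and pid: "pairing_identities M A (bracket A) (anchor A)"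
    using A by (simp_all add: courant_algebroid_def)
  have h: "bundle_map M A A N"
    and tor: "\<And>X Y. X \<in> sections M A \<Longrightarrow> Y \<in> sections M A \<Longrightarrow> torsion M A N X Y = 0"
    and pidN: "pairing_identities M A (contracted M A N) (\<lambda>p v. anchor A p (N p v))"
    and o: "orthogonal_tensor M A N"
    using N by (auto simp: orthogonal_courant_nijenhuis_def courant_nijenhuis_def
        nijenhuis_tensor_def tensor11_def)
  define n where "n = on_sections M N"
  \<comment> \<open>One form for each point; off the manifold it is 0, so the algebraic identities
    hold there trivially and \<open>p\<close> can range over the whole type.\<close>
  define F where "F p X Y = pair_sections M A X Y p" for p X Y
  note add = sections_add_scale(1)[OF M E] and scale = sections_add_scale(2)[OF M E]
  have diff: "X - Y \<in> sections M A" if "X \<in> sections M A" "Y \<in> sections M A" for X Y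
    using add[OF that(1) scale[OF that(2) that(2), of "-1"]] by simp
  have n_in: "n X \<in> sections M A" if "X \<in> sections M A" for X
    unfolding n_def using on_sections_in_sections[OF M E h that] .
  have b_in: "bracket A X Y \<in> sections M A" if "X \<in> sections M A" "Y \<in> sections M A" for X Y
    using b that by (simp add: bilinear_product_def)
  have val: "X p \<in> fibre A p" if "X \<in> sections M A" "p \<in> points M" for X p
    using that by (simp add: sections_def)
  note pb = pairing_bilinear[OF P subspace_fibre[OF M E]]
  have n_lin: "n (X + c *\<^sub>R Y) = n X + c *\<^sub>R n Y" if "X \<in> sections M A" "Y \<in> sections M A" for X Y c
  proof
    fix p
    show "n (X + c *\<^sub>R Y) p = (n X + c *\<^sub>R n Y) p"
      using bundle_mapD(1)[OF M E h, of p] val that subspace_scale[OF subspace_fibre[OF M E]]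
      by (auto simp: n_def on_sections_def linear_on_def scaleR_fun_def)
  qed
  have F_lin: "F p X (Y + c *\<^sub>R Z) = F p X Y + c * F p X Z"
    if "X \<in> sections M A" "Y \<in> sections M A" "Z \<in> sections M A" for p X Y Z c
    using pb(2)[of p "X p" "Y p" "c *\<^sub>R Z p"] pb(3)[of p "X p" "Z p" c] val that
      subspace_scale[OF subspace_fibre[OF M E]]
    by (auto simp: F_def pair_sections_def scaleR_fun_def)
  \<comment> \<open>Both sides are half of the same anchor term.\<close>
  have inv: "F p X (bracket A Y Y) = F p (bracket A X Y) Y"
    and rho: "p \<in> points M \<Longrightarrow> anchor A p (X p) (pair_sections M A Y Y) = 2 * F p X (bracket A Y Y)"
    if "X \<in> sections M A" "Y \<in> sections M A" for p X Y
    using pid that unfolding pairing_identities_def F_def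
    by (cases "p \<in> points M"; fastforce simp: pair_sections_def)+
  have compat: "F p (n X) (bracket A Y Y) = F p X (contracted M A N Y Y)"
    "F p (n X) (bracket A Y Y) = F p (contracted M A N X Y) Y"
    if "X \<in> sections M A" "Y \<in> sections M A" for p X Y
  proof -
    have "F p (n X) (bracket A Y Y) = F p X (contracted M A N Y Y) \<and>
      F p (n X) (bracket A Y Y) = F p (contracted M A N X Y) Y"
    proof (cases "p \<in> points M")
      case True
      \<comment> \<open>Hence the anchor term in the identities of the contracted product for
        \<open>X\<close> is the original anchor term for the section \<open>n X\<close>, to which
        \<open>rho\<close> applies.\<close>
      then have "n X p = N p (X p)" by (simp add: n_def on_sections_def)
      then show ?thesis
        using pidN[unfolded pairing_identities_def, rule_format, OF that True]
          rho[OF n_in[OF that(1)] that(2) True]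
        by (simp add: F_def)
    qed (simp add: F_def pair_sections_def)
    then show "F p (n X) (bracket A Y Y) = F p X (contracted M A N Y Y)"
      "F p (n X) (bracket A Y Y) = F p (contracted M A N X Y) Y" by auto
  qed
  interpret skew_nijenhuis "sections M A" "bracket A" n F
  proof
    fix X Y assume XY: "X \<in> sections M A" "Y \<in> sections M A"
    show "F p X Y = F p Y X" for p
      using pb(1) val XY by (simp add: F_def pair_sections_def)
    show "F p (n X) Y = - F p X (n Y)" for p
      using orthogonal_tensor_skew[OF A o] val XY
      by (simp add: F_def pair_sections_def n_def on_sections_def)
    show "n (X + Y) = n X + n Y" using n_lin[OF XY, of 1] by simp
    show "n (X - Y) = n X - n Y" using n_lin[OF XY, of "-1"] by simp
    show "bracket A (n X) (n Y) = n (bracket A (n X) Y + bracket A X (n Y) - n (bracket A X Y))"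
      using tor[OF XY] by (simp add: torsion_def contracted_def n_def)
    show "F p (n X) (bracket A Y Y) = F p X (bracket A (n Y) Y + bracket A Y (n Y) - n (bracket A Y Y))"
      "F p (n X) (bracket A Y Y) = F p (bracket A (n X) Y + bracket A X (n Y) - n (bracket A X Y)) Y" for p
      using compat[OF XY, of p] by (simp_all add: contracted_def n_def)
  next
    fix X Y Z assume XYZ: "X \<in> sections M A" "Y \<in> sections M A" "Z \<in> sections M A"
    show "bracket A (X + Y) Z = bracket A X Z + bracket A Y Z"
      "bracket A X (Y + Z) = bracket A X Y + bracket A X Z"
      using b XYZ by (simp_all add: bilinear_product_def linear_on_def)
    show "F p X (Y + Z) = F p X Y + F p X Z" "F p X (Y - Z) = F p X Y - F p X Z" for p
      using F_lin[OF XYZ, of p 1] F_lin[OF XYZ, of p "-1"] by simp_all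
  next
    fix X assume X: "X \<in> sections M A" and 0: "\<And>p Y. Y \<in> sections M A \<Longrightarrow> F p X Y = 0"
    show "X = 0"
    proof
      fix p
      show "X p = 0 p"
      proof (cases "p \<in> points M")
        case True
        have "pairing A p (X p) w = 0" if w: "w \<in> fibre A p" for w
        proof -
          obtain Y where "Y \<in> sections M A" "Y p = w"
            using section_through[OF M E True w] .
          then show ?thesis using 0[of Y p] True by (simp add: F_def pair_sections_def)
        qed
        then show ?thesis
          using P True val[OF X True] unfolding nondegenerate_pairing_def by auto
      qed (use X in \<open>simp add: sections_def\<close>)
    qed
  qed (use add diff b_in n_in inv in auto)
  show "bracket A X (on_sections M (tensor_square N) Y) =
      on_sections M (tensor_square N) (bracket A X Y)"
    using m_square_right[OF X Y] by (simp add: on_sections_tensor_square n_def)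
  show "on_sections M (tensor_square N) (bracket A Y Y) =
      bracket A (on_sections M (tensor_square N) Y) Y"
    using square_m_self[OF Y] by (simp add: on_sections_tensor_square n_def)
qed

text \<open>Everything is homogeneous in \<open>N\<close>: the contracted product, the composed
  anchor and the adjoint have degree 1, the torsion degree 2.\<close>

lemma orthogonal_courant_nijenhuis_scale:
  fixes M :: "'m manifold" and A :: "('m, 'v::real_vector) courant"
  assumes A: "courant_algebroid M A" and N: "orthogonal_courant_nijenhuis M A N"
  shows "orthogonal_courant_nijenhuis M A (\<lambda>p v. a *\<^sub>R N p v)" (is "orthogonal_courant_nijenhuis M A ?J")
proof -
  have M: "smooth_manifold M" and E: "vector_bundle M A" and P: "nondegenerate_pairing M A"
    and b: "bilinear_product M A (bracket A)" and \<rho>: "bundle_map M A (tangent_bundle M) (anchor A)"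
    using A by (simp_all add: courant_algebroid_def)
  have h: "bundle_map M A A N"
    and tor: "\<And>X Y. X \<in> sections M A \<Longrightarrow> Y \<in> sections M A \<Longrightarrow> torsion M A N X Y = 0"
    and pid: "pairing_identities M A (contracted M A N) (\<lambda>p v. anchor A p (N p v))"
    and o: "orthogonal_tensor M A N"
    using N by (auto simp: orthogonal_courant_nijenhuis_def courant_nijenhuis_def
        nijenhuis_tensor_def tensor11_def)
  note in_bundle = bundle_map_scale[OF M E]
  note sub = subspace_fibre[OF M E]
  note add = sections_add_scale(1)[OF M E] and scale = sections_add_scale(2)[OF M E]
  have diff: "X - Y \<in> sections M A" if "X \<in> sections M A" "Y \<in> sections M A" for X Y
    using add[OF that(1) scale[OF that(2) that(2), of "-1"]] by simp
  define n where "n = on_sections M N"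
  have nJ: "on_sections M ?J X = a *\<^sub>R n X" for X
    by (auto simp: n_def on_sections_def scaleR_fun_def)
  have n_in: "n X \<in> sections M A" if "X \<in> sections M A" for X
    unfolding n_def using on_sections_in_sections[OF M E h that] .
  have b_in: "bracket A X Y \<in> sections M A" if "X \<in> sections M A" "Y \<in> sections M A" for X Y
    using b that by (simp add: bilinear_product_def)
  have b_scale: "bracket A (c *\<^sub>R X) Y = c *\<^sub>R bracket A X Y" "bracket A X (c *\<^sub>R Y) = c *\<^sub>R bracket A X Y"
    if "X \<in> sections M A" "Y \<in> sections M A" for X Y c
    using b that by (simp_all add: bilinear_product_def linear_on_def)
  have val: "X p \<in> fibre A p" if "X \<in> sections M A" "p \<in> points M" for X p
    using that by (simp add: sections_def)
  have n_scale: "n (c *\<^sub>R X) = c *\<^sub>R n X" if "X \<in> sections M A" for X c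
    using bundle_mapD(1)[OF M E h] val[OF that]
    by (auto simp: n_def on_sections_def linear_on_def scaleR_fun_def)
  have contr: "contracted M A ?J X Y = a *\<^sub>R contracted M A N X Y"
    if "X \<in> sections M A" "Y \<in> sections M A" for X Y
    unfolding contracted_def nJ using that
    by (simp add: b_scale n_in n_def[symmetric] scaleR_diff_right scaleR_add_right)
  have contr_in: "contracted M A N X Y \<in> sections M A"
    if "X \<in> sections M A" "Y \<in> sections M A" for X Y
    unfolding contracted_def n_def[symmetric] using that by (simp add: add diff b_in n_in)
  have "torsion M A ?J X Y = 0" if "X \<in> sections M A" "Y \<in> sections M A" for X Y
  proof -
    have "torsion M A ?J X Y = (a * a) *\<^sub>R torsion M A N X Y"
      unfolding torsion_def nJ contr[OF that] using that
      by (simp add: b_scale n_in scale n_scale contr_in n_def[symmetric] scaleR_diff_right)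
    then show ?thesis using tor[OF that] by simp
  qed
  moreover have "pairing_identities M A (contracted M A ?J) (\<lambda>p v. anchor A p (?J p v))"
    unfolding pairing_identities_def
  proof (intro ballI)
    fix X Y p assume X: "X \<in> sections M A" and Y: "Y \<in> sections M A" and p: "p \<in> points M"
    have "anchor A p (a *\<^sub>R N p (X p)) = a *\<^sub>R anchor A p (N p (X p))"
      using \<rho> p bundle_mapD(2)[OF M E h p val[OF X p]] by (simp add: bundle_map_def linear_on_def)
    then have 1: "anchor A p (a *\<^sub>R N p (X p)) f = a * anchor A p (N p (X p)) f" for f
      by (simp add: scaleR_fun_def)
    note pb = pairing_bilinear[OF P sub[OF p] p]
    have 2: "pair_sections M A X (a *\<^sub>R contracted M A N Y Y) p = a * pair_sections M A X (contracted M A N Y Y) p"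
      using pb(3)[OF val[OF X p] val[OF contr_in[OF Y Y] p]] p
      by (simp add: pair_sections_def scaleR_fun_def)
    have 3: "pair_sections M A (a *\<^sub>R contracted M A N X Y) Y p = a * pair_sections M A (contracted M A N X Y) Y p"
      using pb(4)[OF val[OF Y p] val[OF contr_in[OF X Y] p]] p
      by (simp add: pair_sections_def scaleR_fun_def)
    show "anchor A p (?J p (X p)) (pair_sections M A Y Y) = 2 * pair_sections M A X (contracted M A ?J Y Y) p \<and>
       anchor A p (?J p (X p)) (pair_sections M A Y Y) = 2 * pair_sections M A (contracted M A ?J X Y) Y p"
      using pid[unfolded pairing_identities_def, rule_format, OF X Y p]
      by (simp add: 1 2 3 contr X Y)
  qed
  moreover have "orthogonal_tensor M A ?J"
  proof -
    obtain N' where N': "is_adjoint M A N N'" "tensor_eq M A (N + N') (scalar_tensor 0)"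
      using o unfolding orthogonal_tensor_def by blast
    have h': "bundle_map M A A N'" using N'(1) by (simp add: is_adjoint_def tensor11_def)
    have "is_adjoint M A ?J (\<lambda>p v. a *\<^sub>R N' p v)"
      unfolding is_adjoint_def tensor11_def
    proof (intro conjI ballI in_bundle[OF h'])
      fix p v w assume p: "p \<in> points M" and v: "v \<in> fibre A p" and w: "w \<in> fibre A p"
      note pb = pairing_bilinear[OF P sub[OF p] p]
      show "pairing A p (a *\<^sub>R N p v) w = pairing A p v (a *\<^sub>R N' p w)"
        using pb(4)[OF w bundle_mapD(2)[OF M E h p v]] pb(3)[OF v bundle_mapD(2)[OF M E h' p w]]
          N'(1) p v w by (simp add: is_adjoint_def)
    qed
    moreover have "tensor_eq M A (?J + (\<lambda>p v. a *\<^sub>R N' p v)) (scalar_tensor 0)"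
      using N'(2) by (simp add: tensor_eq_def scalar_tensor_def scaleR_add_right[symmetric])
    ultimately show ?thesis unfolding orthogonal_tensor_def by blast
  qed
  ultimately show ?thesis
    using in_bundle[OF h] by (simp add: orthogonal_courant_nijenhuis_def courant_nijenhuis_def
        nijenhuis_tensor_def tensor11_def)
qed

theorem corollary2:
  fixes M :: "'m manifold"
    and A :: "('m, 'v::real_vector) courant"
    and N :: "'m \<Rightarrow> 'v \<Rightarrow> 'v"
  assumes "irreducible_courant_algebroid M A"
    and "orthogonal_courant_nijenhuis M A N"
  shows "\<exists>(c::real) J.
    (complex_courant_structure M A J \<or> product_courant_structure M A J \<or>
     tangent_courant_structure M A J) \<and>
    tensor_eq M A N (\<lambda>p v. c *\<^sub>R J p v)"
proof -
  have A: "courant_algebroid M A"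
    using assms(1) by (simp add: irreducible_courant_algebroid_def)
  then have M: "smooth_manifold M" and E: "vector_bundle M A"
    by (simp_all add: courant_algebroid_def)
  have h: "bundle_map M A A N"
    using assms(2) by (simp add: orthogonal_courant_nijenhuis_def courant_nijenhuis_def
        nijenhuis_tensor_def tensor11_def)
  have "tensor11 M A (tensor_square N)"
    using bundle_map_comp[OF M E h h] by (simp add: tensor11_def tensor_square_def)
  then obtain c where sq: "tensor_eq M A (tensor_square N) (scalar_tensor c)"
    using assms(1) orthogonal_courant_nijenhuis_square[OF A assms(2)]
    unfolding irreducible_courant_algebroid_def by metis
  show ?thesis
  proof (cases "c = 0")
    case True
    then have "tangent_courant_structure M A N"
      using sq assms(2) by (simp add: tangent_courant_structure_def)
    then show ?thesis
      by (intro exI[of _ 1] exI[of _ N]) (simp add: tensor_eq_def)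
  next
    case False
    \<comment> \<open>The square of \<open>N\<close> divided by \<open>a\<close> is c / |c| =
      \<open>sgn c\<close> times the identity: a negative \<open>c\<close> leads to the complex
      case, a positive one to the product case.\<close>
    define a where "a = sqrt \<bar>c\<bar>"
    define J where "J = (\<lambda>p v. inverse a *\<^sub>R N p v)"
    have a: "a \<noteq> 0" "inverse a * inverse a * c = sgn c"
      using False by (auto simp: a_def sgn_if field_simps)
    have "N p (c *\<^sub>R N p v) = c *\<^sub>R N p (N p v)" if "p \<in> points M" "v \<in> fibre A p" for p v c
      using bundle_mapD(1,2)[OF M E h that(1)] that by (simp add: linear_on_def)
    then have "tensor_eq M A (tensor_square J) (scalar_tensor (sgn c))"
      using sq a(2) by (simp add: tensor_eq_def tensor_square_def scalar_tensor_def J_def)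
    then have "complex_courant_structure M A J \<or> product_courant_structure M A J"
      using False orthogonal_courant_nijenhuis_scale[OF A assms(2), of "inverse a"]
      by (auto simp: complex_courant_structure_def product_courant_structure_def J_def[symmetric]
          sgn_if split: if_splits)
    moreover have "tensor_eq M A N (\<lambda>p v. a *\<^sub>R J p v)"
      using a(1) by (simp add: tensor_eq_def J_def)
    ultimately show ?thesis by blast
  qed
qed

end
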